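(* Let $1<p<\infty$ and $q=p/(p-1)$. Let $k\in A^q$, $k\not\equiv0$, and let $F$ be the $A^p$ extremal function for $k$. (i) If $F\in A^{(p-1)q_1}$ for some $1<q_1<\infty$, then $k\in A^{q_1}$. (ii) If $F\in H^\infty$, then $k$ belongs to the Bloch space. (iii) If $F$ extends continuously to the closed disc $\overline{\mathbb{D}}$, then $k$ belongs to the little Bloch space.
   Context: $\mathbb{D}$ is the open unit disc and $\sigma$ is normalized area measure on $\mathbb{D}$. For $1<p<\infty$, $A^p$ is the Bergman space of analytic $f$ on $\mathbb{D}$ with $\|f\|_{A^p}=(\int_{\mathbb{D}}|f|^p\,d\sigma)^{1/p}<\infty$; $H^\infty$ is the space of bounded analytic functions on $\mathbb{D}$. The Bloch space consists of analytic $f$ on $\mathbb{D}$ with $\sup_{z\in\mathbb{D}}(1-|z|^2)|f'(z)|<\infty$, and the little Bloch space of those with $(1-|z|^2)|f'(z)|\to0$ as $|z|\to1$. For $k\in A^q$, $k\not\equiv0$, the functional with kernel $k$ is $\phi(f)=\int_{\mathbb{D}} f\,\overline{k}\,d\sigma$ on $A^p$, with norm $\|\phi\|$ in $(A^p)^*$. The extremal function for $k$ is the unique $F\in A^p$ with $\|F\|_{A^p}=1$ and $\operatorname{Re}\phi(F)=\sup_{\|g\|_{A^p}=1}\operatorname{Re}\phi(g)=\|\phi\|$. *)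

theory Defs
  imports "HOL-Analysis.Analysis"
begin

definition disc :: "complex set" where
  "disc = ball 0 1"

definition sigma_integral :: "(complex \<Rightarrow> complex) \<Rightarrow> complex" where
  "sigma_integral f = complex_of_real (1 / pi) * (LINT z : disc | lborel. f z)"

definition bergman :: "real \<Rightarrow> (complex \<Rightarrow> complex) set" where
  "bergman p = {f. f holomorphic_on disc \<and>
                   set_integrable lborel disc (\<lambda>z. norm (f z) powr p)}"

definition bergman_norm :: "real \<Rightarrow> (complex \<Rightarrow> complex) \<Rightarrow> real" where
  "bergman_norm p f = ((1 / pi) * (LINT z : disc | lborel. norm (f z) powr p)) powr (1 / p)"

definition Hinf :: "(complex \<Rightarrow> complex) set" where
  "Hinf = {f. f holomorphic_on disc \<and> bounded (f ` disc)}"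

definition bloch :: "(complex \<Rightarrow> complex) set" where
  "bloch = {f. f holomorphic_on disc \<and>
              bdd_above ((\<lambda>z. (1 - (norm z)\<^sup>2) * norm (deriv f z)) ` disc)}"

definition little_bloch :: "(complex \<Rightarrow> complex) set" where
  "little_bloch = {f. f holomorphic_on disc \<and>
     (\<forall>e>0. \<exists>r<1. \<forall>z\<in>disc. r < norm z \<longrightarrow> (1 - (norm z)\<^sup>2) * norm (deriv f z) < e)}"

definition kernel_functional :: "(complex \<Rightarrow> complex) \<Rightarrow> (complex \<Rightarrow> complex) \<Rightarrow> complex" where
  "kernel_functional k f = sigma_integral (\<lambda>z. f z * cnj (k z))"

text \<open>F is the A^p extremal function for k: unit norm, and it maximizes Re phi
  over the unit sphere of A^p (the supremum, which equals the functional norm, is attained at F).\<close>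
definition extremal :: "real \<Rightarrow> (complex \<Rightarrow> complex) \<Rightarrow> (complex \<Rightarrow> complex) \<Rightarrow> bool" where
  "extremal p k F \<longleftrightarrow> F \<in> bergman p \<and> bergman_norm p F = 1 \<and>
     (\<forall>g\<in>bergman p. bergman_norm p g = 1 \<longrightarrow>
        Re (kernel_functional k g) \<le> Re (kernel_functional k F))"

end

theory Submission
  imports Defs "HOL-Complex_Analysis.Complex_Analysis"
begin

text \<open>
  Differentiating \<open>t \<mapsto> \<parallel>\<phi>\<parallel> \<parallel>F + t h\<parallel> - Re \<phi> (F + t h)\<close> at its minimum \<open>t = 0\<close> shows that \<open>k\<close> and
  \<open>\<parallel>\<phi>\<parallel> \<bar>F\<bar>\<^bsup>p-2\<^esup> F\<close> have the same pairing with every bounded analytic \<open>h\<close>. Taking for \<open>h\<close> the Bergman kernel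
  and its derivative, \<open>k\<close> is the Bergman projection of \<open>\<parallel>\<phi>\<parallel> \<bar>F\<bar>\<^bsup>p-2\<^esup> F\<close>, and the three claims
  become mapping properties of that projection: it is bounded on \<open>L\<^bsup>q\<^esup>\<close> for \<open>1 < q < \<infinity>\<close> (Schur's test),
  and it maps bounded functions to the Bloch space and functions continuous on the closed disc to
  the little Bloch space, because the kernel \<open>\<bar>1 - z cnj w\<bar>\<^bsup>-3\<^esup>\<close> has integral of order
  \<open>1 / (1 - \<bar>z\<bar>\<^sup>2)\<close> over the disc.
\<close>

section \<open>Rotation invariance of area measure\<close>

text \<open>The function \<open>|F|^(p-2) F\<close> is in general not analytic, so it cannot be
  identified with a multiple of \<open>k\<close>: only the pairings with analytic functions agree,
  and a reproducing formula is needed to read off values of \<open>k\<close> and of its derivative.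
  Bounded test functions suffice, because for fixed \<open>z\<close> in the disc both kernels are
  bounded in \<open>w\<close>; boundedness also supplies the dominating function for the limit in
  \<open>t\<close>. The exponent in (i) comes from the modulus of this function, which is
  \<open>|F|^(p-1)\<close>: it lies in \<open>L^q1\<close> exactly when
  \<open>|F|^((p-1) q1)\<close> is integrable. In (iii) size estimates alone would give only the
  Bloch space, since the growth of the kernel integral just balances the weight
  \<open>1 - |z|^2\<close>; the gain must come from cancellation. All area integrals are evaluated
  by one device. On the unit circle \<open>cnj v = 1 / v\<close>, so after a rotation the kernels
  are rational in \<open>v\<close>, Cauchy's formula gives their circle means, and an integral in
  \<open>s = |w|^2\<close> remains.\<close>

lemma lborel_complex_eq:
  "(lborel :: complex measure) = distr (lborel \<Otimes>\<^sub>M lborel) borel (\<lambda>(x, y). Complex x y)"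
proof (rule lborel_eqI)
  have [measurable]: "(\<lambda>(x, y). Complex x y) \<in> borel_measurable (lborel \<Otimes>\<^sub>M lborel)"
    unfolding lborel_prod case_prod_unfold Complex_eq measurable_lborel2
    by (intro borel_measurable_continuous_onI continuous_intros)
  fix l u :: complex
  assume "\<And>b. b \<in> Basis \<Longrightarrow> l \<bullet> b \<le> u \<bullet> b"
  from this[of 1] this[of \<i>] have le: "Re l \<le> Re u" "Im l \<le> Im u"
    by (auto simp: Basis_complex_def)
  have "emeasure (distr (lborel \<Otimes>\<^sub>M lborel) borel (\<lambda>(x, y). Complex x y)) (box l u)
      = emeasure (lborel \<Otimes>\<^sub>M lborel) (box (Re l) (Re u) \<times> box (Im l) (Im u))"
    by (subst emeasure_distr)
      (auto simp: space_pair_measure in_box_complex_iff box_real intro!: arg_cong[where f="emeasure _"])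
  also have "\<dots> = ennreal ((Re u - Re l) * (Im u - Im l))"
    using le by (simp add: lborel.emeasure_pair_measure_Times ennreal_mult)
  finally show "emeasure (distr (lborel \<Otimes>\<^sub>M lborel) borel (\<lambda>(x, y). Complex x y)) (box l u)
      = (\<Prod>b\<in>Basis. (u - l) \<bullet> b)"
    by (simp add: Basis_complex_def mult.commute)
qed simp

lemma borel_measurable_Complex [measurable (raw)]:
  assumes [measurable]: "f \<in> borel_measurable M" "g \<in> borel_measurable M"
  shows "(\<lambda>x. Complex (f x) (g x)) \<in> borel_measurable M"
  unfolding Complex_eq by measurable

text \<open>Both orders of integration are recorded because a horizontal shear is a translation on
  each line of constant imaginary part and a vertical one on each line of constant real part: the
  inner integral must run in the direction of the shear.\<close>

lemma nn_integral_lborel_complex: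
  fixes f :: "complex \<Rightarrow> ennreal"
  assumes [measurable]: "f \<in> borel_measurable borel"
  shows "(\<integral>\<^sup>+w. f w \<partial>lborel) = (\<integral>\<^sup>+x. \<integral>\<^sup>+y. f (Complex x y) \<partial>lborel \<partial>lborel)"
    and "(\<integral>\<^sup>+w. f w \<partial>lborel) = (\<integral>\<^sup>+y. \<integral>\<^sup>+x. f (Complex x y) \<partial>lborel \<partial>lborel)"
proof -
  have "(\<integral>\<^sup>+w. f w \<partial>lborel) = (\<integral>\<^sup>+p. f (case p of (x, y) \<Rightarrow> Complex x y) \<partial>(lborel \<Otimes>\<^sub>M lborel))"
    by (subst lborel_complex_eq, subst nn_integral_distr) (auto simp: case_prod_unfold)
  also have "\<dots> = (\<integral>\<^sup>+x. \<integral>\<^sup>+y. f (Complex x y) \<partial>lborel \<partial>lborel)"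
    by (subst lborel.nn_integral_fst[symmetric]) (auto simp: case_prod_unfold)
  finally show 1: "(\<integral>\<^sup>+w. f w \<partial>lborel) = (\<integral>\<^sup>+x. \<integral>\<^sup>+y. f (Complex x y) \<partial>lborel \<partial>lborel)" .
  show "(\<integral>\<^sup>+w. f w \<partial>lborel) = (\<integral>\<^sup>+y. \<integral>\<^sup>+x. f (Complex x y) \<partial>lborel \<partial>lborel)"
    unfolding 1 by (rule lborel_pair.Fubini'[symmetric]) simp
qed

lemma nn_integral_shear_Re:
  fixes f :: "complex \<Rightarrow> ennreal"
  assumes [measurable]: "f \<in> borel_measurable borel"
  shows "(\<integral>\<^sup>+w. f (w + of_real (t * Im w)) \<partial>lborel) = (\<integral>\<^sup>+w. f w \<partial>lborel)"
proof -
  have "(\<integral>\<^sup>+x. f (Complex x y) \<partial>lborel) = (\<integral>\<^sup>+x. f (Complex (t * y + 1 * x) y) \<partial>lborel)" for y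
    by (subst nn_integral_real_affine[where t="t * y" and c=1]) auto
  then show ?thesis
    by (subst (1 2) nn_integral_lborel_complex(2)) (auto simp: complex_eq_iff add.commute intro!: nn_integral_cong arg_cong[where f=f])
qed

lemma nn_integral_shear_Im:
  fixes f :: "complex \<Rightarrow> ennreal"
  assumes [measurable]: "f \<in> borel_measurable borel"
  shows "(\<integral>\<^sup>+w. f (w + \<i> * of_real (t * Re w)) \<partial>lborel) = (\<integral>\<^sup>+w. f w \<partial>lborel)"
proof -
  have "(\<integral>\<^sup>+y. f (Complex x y) \<partial>lborel) = (\<integral>\<^sup>+y. f (Complex x (t * x + 1 * y)) \<partial>lborel)" for x
    by (subst nn_integral_real_affine[where t="t * x" and c=1]) auto
  then show ?thesis
    by (subst (1 2) nn_integral_lborel_complex(1)) (auto simp: complex_eq_iff add.commute intro!: nn_integral_cong arg_cong[where f=f])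
qed

text \<open>A rotation other than \<open>\<plusminus>1\<close> is a product of three shears.\<close>

lemma nn_integral_rotate:
  fixes f :: "complex \<Rightarrow> ennreal"
  assumes [measurable]: "f \<in> borel_measurable borel" and c: "norm c = 1"
  shows "(\<integral>\<^sup>+w. f (c * w) \<partial>lborel) = (\<integral>\<^sup>+w. f w \<partial>lborel)"
proof -
  have *: "(\<integral>\<^sup>+w. f (c * w) \<partial>lborel) = (\<integral>\<^sup>+w. f w \<partial>lborel)"
    if [measurable]: "f \<in> borel_measurable borel" and c: "norm c = 1" and b: "Im c \<noteq> 0"
    for f :: "complex \<Rightarrow> ennreal" and c
  proof -
    \<comment> \<open>With \<open>c = cis \<theta>\<close> the shear factors are
      \<open>t = - tan (\<theta> / 2)\<close> (horizontal, used twice) and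
      \<open>sin \<theta>\<close> (vertical). The equation \<open>tb\<close> gives the diagonal
      entries of the matrix of the product, and \<open>tt\<close> its upper right entry.\<close>
    define t where "t = (Re c - 1) / Im c"
    define X Y where "X = (\<lambda>w. w + of_real (t * Im w))" and "Y = (\<lambda>w. w + \<i> * of_real (Im c * Re w))"
    have tb: "t * Im c = Re c - 1"
      using b by (simp add: t_def)
    have "(Re c)\<^sup>2 + (Im c)\<^sup>2 = 1"
      using c by (simp add: cmod_def)
    then have tt: "t * (1 + Re c) = - Im c"
      using b by (simp add: t_def field_simps power2_eq_square)
    have "X (Y (X w)) = c * w" for w
    proof -
      have "Re w + t * Im w + t * (Im w + Im c * (Re w + t * Im w))
          = Re w * (1 + t * Im c) + (t + t * (1 + t * Im c)) * Im w"
        by (simp add: algebra_simps)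
      also have "\<dots> = Re c * Re w - Im c * Im w"
        using tt by (simp add: tb algebra_simps flip: distrib_right)
      finally have 1: "Re w + t * Im w + t * (Im w + Im c * (Re w + t * Im w)) = Re c * Re w - Im c * Im w" .
      have "Im w + Im c * (Re w + t * Im w) = Im c * Re w + (1 + t * Im c) * Im w"
        by (simp add: algebra_simps)
      also have "\<dots> = Im c * Re w + Re c * Im w"
        by (simp add: tb)
      finally show ?thesis
        using 1 by (simp add: X_def Y_def complex_eq_iff)
    qed
    then have "(\<integral>\<^sup>+w. f (c * w) \<partial>lborel) = (\<integral>\<^sup>+w. f (X (Y (X w))) \<partial>lborel)"
      by simp
    also have "\<dots> = (\<integral>\<^sup>+w. f w \<partial>lborel)"
      unfolding X_def Y_def
      by (subst nn_integral_shear_Re, measurable, subst nn_integral_shear_Im, measurable,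
          subst nn_integral_shear_Re, measurable)
    finally show ?thesis .
  qed
  show ?thesis
  proof (cases "Im c = 0")
    case False
    then show ?thesis using * c by simp
  next
    case True
    then have "c = 1 \<or> c = - 1"
      using c by (auto simp: complex_eq_iff cmod_def)
    \<comment> \<open>The factor \<open>t\<close> is undefined for \<open>-1\<close>, which is
      therefore obtained as the rotation by \<open>\<i>\<close> applied twice.\<close>
    moreover have "(\<integral>\<^sup>+w. f (- 1 * w) \<partial>lborel) = (\<integral>\<^sup>+w. f w \<partial>lborel)"
      using *[of "\<lambda>w. f (\<i> * w)" \<i>] *[of f \<i>] by simp
    ultimately show ?thesis by auto
  qed
qed

lemma distr_rotate_lborel:
  fixes c :: complex
  assumes "norm c = 1"
  shows "distr lborel borel ((*) c) = lborel"
proof (rule measure_eqI)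
  fix A assume "A \<in> sets (distr lborel borel ((*) c))"
  then have [measurable]: "A \<in> sets borel" by simp
  have "emeasure (distr lborel borel ((*) c)) A = (\<integral>\<^sup>+w. indicator A w \<partial>distr lborel borel ((*) c))"
    by simp
  also have "\<dots> = (\<integral>\<^sup>+w. indicator A (c * w) \<partial>lborel)"
    by (rule nn_integral_distr) auto
  also have "\<dots> = emeasure lborel A"
    by (subst nn_integral_rotate) (use assms in auto)
  finally show "emeasure (distr lborel borel ((*) c)) A = emeasure lborel A" .
qed simp

text \<open>The disc of radius \<open>sqrt a\<close> has area \<open>pi * a\<close>, which is linear
  in \<open>a\<close>. In the variable \<open>|w|^2\<close> area measure thus has constant density
  \<open>pi\<close>, and no Jacobian appears later.\<close>

lemma distr_norm_square_lborel:
  "distr lborel borel (\<lambda>w::complex. (norm w)\<^sup>2)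
    = density lborel (\<lambda>s. ennreal pi * indicator {0..} s)" (is "?L = ?R")
proof (rule measure_eqI_generator_eq[where E="range atMost" and \<Omega>=UNIV and A="\<lambda>n. {..real n}"])
  show "Int_stable (range (atMost :: real \<Rightarrow> _))"
    by (auto simp: Int_stable_def)
  show "sets ?L = sigma_sets UNIV (range atMost)" "sets ?R = sigma_sets UNIV (range atMost)"
    by (simp_all add: borel_eq_atMost)
  have *: "emeasure ?L {..a} = ennreal (pi * max 0 a)" for a
  proof -
    have "emeasure ?L {..a} = emeasure lborel {w::complex. (norm w)\<^sup>2 \<le> a}"
      by (subst emeasure_distr) (auto intro!: arg_cong[where f="emeasure _"])
    also have "{w::complex. (norm w)\<^sup>2 \<le> a} = (if a < 0 then {} else cball 0 (sqrt a))"
      by (auto simp: real_le_rsqrt not_less) (smt (verit) zero_le_power2, metis norm_ge_zero not_less real_sqrt_le_iff real_sqrt_unique)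
    also have "emeasure lborel \<dots> = ennreal (pi * max 0 a)"
      by (auto simp: emeasure_cball unit_ball_vol_2)
    finally show ?thesis .
  qed
  have **: "emeasure ?R {..a} = ennreal (pi * max 0 a)" for a
  proof -
    have "emeasure ?R {..a} = (\<integral>\<^sup>+s. ennreal pi * indicator {0..a} s \<partial>lborel)"
      by (subst emeasure_density) (auto intro!: nn_integral_cong split: split_indicator)
    also have "\<dots> = ennreal (pi * max 0 a)"
      by (subst nn_integral_cmult) (auto simp: ennreal_mult' max_def)
    finally show ?thesis .
  qed
  show "emeasure ?L X = emeasure ?R X" if "X \<in> range atMost" for X
    using that * ** by auto
  show "emeasure ?L {..real n} \<noteq> \<infinity>" for n
    by (simp add: *)
  show "(\<Union>n. {..real n}) = UNIV"
    by (auto intro: real_arch_simple)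
qed auto

section \<open>Circle averages of area integrals\<close>

abbreviation disc_measure :: "complex measure" where
  "disc_measure \<equiv> restrict_space lborel disc"

abbreviation unit_interval_measure :: "real measure" where
  "unit_interval_measure \<equiv> restrict_space lborel {0..1}"

lemma sets_disc [measurable, simp]: "disc \<in> sets borel"
  by (simp add: disc_def)

lemma space_disc_measure [simp]: "space disc_measure = disc"
  by (simp add: space_restrict_space)

lemma emeasure_disc: "emeasure lborel disc = ennreal pi"
  by (simp add: disc_def emeasure_ball unit_ball_vol_2)

lemma finite_measure_disc: "finite_measure disc_measure"
  by (rule finite_measureI) (simp add: emeasure_restrict_space emeasure_disc)

lemma emeasure_unit_interval: "emeasure unit_interval_measure {0..1} = 1"
  by (simp add: emeasure_restrict_space)

lemma finite_measure_unit_interval: "finite_measure unit_interval_measure"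
  by (rule finite_measureI) (simp add: emeasure_unit_interval space_restrict_space)

lemma measure_disc: "measure disc_measure disc = pi"
  by (simp add: measure_def emeasure_restrict_space emeasure_disc)

lemma measurable_disc_continuous:
  "continuous_on disc f \<Longrightarrow> f \<in> borel_measurable disc_measure"
  using borel_measurable_continuous_on_restrict[of disc f]
  by (simp cong: measurable_cong_sets add: sets_restrict_space)

lemma rotate_disc_iff: "norm c = 1 \<Longrightarrow> c * w \<in> disc \<longleftrightarrow> w \<in> disc"
  by (simp add: disc_def norm_mult)

lemma distr_rotate_disc:
  assumes "norm c = 1"
  shows "distr disc_measure disc_measure ((*) c) = disc_measure"
proof (rule measure_eqI)
  have m: "(*) c \<in> disc_measure \<rightarrow>\<^sub>M disc_measure"
    using assms by (intro measurable_restrict_space3) (auto simp: rotate_disc_iff)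
  fix X assume "X \<in> sets (distr disc_measure disc_measure ((*) c))"
  then have X: "X \<subseteq> disc" "X \<in> sets borel" "X \<in> sets disc_measure"
    by (auto simp: sets_restrict_space)
  have "emeasure (distr disc_measure disc_measure ((*) c)) X = emeasure disc_measure ((*) c -` X \<inter> disc)"
    using m X by (subst emeasure_distr) auto
  also have "\<dots> = emeasure lborel ((*) c -` X)"
  proof -
    have "(*) c -` X \<subseteq> disc"
      using X(1) rotate_disc_iff[OF assms] by blast
    then show ?thesis
      by (subst emeasure_restrict_space) (auto simp: Int_absorb2)
  qed
  also have "\<dots> = emeasure (distr lborel borel ((*) c)) X"
    using X by (simp add: emeasure_distr)
  also have "\<dots> = emeasure disc_measure X"
    using X by (simp add: distr_rotate_lborel assms emeasure_restrict_space)
  finally show "emeasure (distr disc_measure disc_measure ((*) c)) X = emeasure disc_measure X" .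
qed simp

lemma distr_norm_square_disc:
  "distr disc_measure borel (\<lambda>w. (norm w)\<^sup>2)
    = density lborel (\<lambda>s. ennreal pi * indicator {0..<1} s)" (is "?L = ?R")
proof (rule measure_eqI)
  fix X assume "X \<in> sets ?L"
  then have [measurable]: "X \<in> sets borel" by simp
  have [measurable]: "(\<lambda>w. (norm w)\<^sup>2) \<in> borel_measurable disc_measure"
    by (intro measurable_disc_continuous continuous_intros)
  have "emeasure ?L X = emeasure disc_measure {w \<in> disc. (norm w)\<^sup>2 \<in> X}"
    by (subst emeasure_distr) (auto intro!: arg_cong[where f="emeasure _"])
  also have "\<dots> = emeasure lborel ((\<lambda>w::complex. (norm w)\<^sup>2) -` (X \<inter> {..<1}))"
    by (subst emeasure_restrict_space)
      (auto intro!: arg_cong[where f="emeasure _"] simp: disc_def abs_square_less_1)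
  also have "\<dots> = emeasure (distr lborel borel (\<lambda>w::complex. (norm w)\<^sup>2)) (X \<inter> {..<1})"
    by (subst emeasure_distr) auto
  also have "\<dots> = emeasure ?R X"
    unfolding distr_norm_square_lborel
    by (auto simp: emeasure_density intro!: nn_integral_cong split: split_indicator)
  finally show "emeasure ?L X = emeasure ?R X" .
qed simp

lemma cis_mult_measurable:
  "(\<lambda>(t, w). cis (2 * pi * t) * w) \<in> unit_interval_measure \<Otimes>\<^sub>M disc_measure \<rightarrow>\<^sub>M disc_measure"
proof (rule measurable_restrict_space2)
  show "(\<lambda>(t, w). cis (2 * pi * t) * w) \<in> space (unit_interval_measure \<Otimes>\<^sub>M disc_measure) \<rightarrow> disc"
    by (auto simp: space_pair_measure rotate_disc_iff)
  have c: "(\<lambda>t. cis (2 * pi * t)) \<in> borel_measurable borel"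
    by (intro borel_measurable_continuous_onI continuous_intros)
  have "(\<lambda>t. cis (2 * pi * t)) \<in> unit_interval_measure \<rightarrow>\<^sub>M borel"
    using c by (intro measurable_restrict_space1) simp
  from measurable_compose[OF measurable_fst this]
  have "(\<lambda>p. cis (2 * pi * fst p)) \<in> borel_measurable (unit_interval_measure \<Otimes>\<^sub>M disc_measure)" .
  moreover have "(\<lambda>w. w) \<in> disc_measure \<rightarrow>\<^sub>M borel"
    by (intro measurable_restrict_space1) simp
  from measurable_compose[OF measurable_snd this]
  have "snd \<in> borel_measurable (unit_interval_measure \<Otimes>\<^sub>M disc_measure)" .
  ultimately show "(\<lambda>(t, w). cis (2 * pi * t) * w)
      \<in> unit_interval_measure \<Otimes>\<^sub>M disc_measure \<rightarrow>\<^sub>M lborel"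
    by (simp add: case_prod_unfold)
qed

lemma has_integral_unit_interval_measure:
  fixes f :: "real \<Rightarrow> complex"
  assumes "continuous_on {0..1} f" "(f has_integral I) {0..1}"
  shows "integral\<^sup>L unit_interval_measure f = I"
proof -
  have "set_integrable lborel {0..1} f"
    unfolding set_integrable_def by (rule borel_integrable_compact) (use assms in auto)
  then have "(LINT t:{0..1}|lborel. f t) = integral {0..1} f"
    by (rule set_borel_integral_eq_integral)
  then show ?thesis
    using assms(2) by (simp add: integral_restrict_space set_lebesgue_integral_def integral_unique)
qed

lemma nn_integral_unit_interval_measure:
  fixes f :: "real \<Rightarrow> real"
  assumes "\<And>t. t \<in> {0..1} \<Longrightarrow> 0 \<le> f t" "(f has_integral I) {0..1}"
  shows "(\<integral>\<^sup>+t. ennreal (f t) \<partial>unit_interval_measure) = ennreal I"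
proof -
  have "(\<integral>\<^sup>+t. ennreal (f t) \<partial>unit_interval_measure) = (\<integral>\<^sup>+t. ennreal (indicator {0..1} t * f t) \<partial>lborel)"
    by (simp add: nn_integral_restrict_space) (auto intro!: nn_integral_cong split: split_indicator)
  then show ?thesis
    using nn_integral_has_integral_lebesgue[OF assms] by simp
qed

text \<open>Area integrals reduce to one-dimensional ones: average over rotations, then push forward
  along \<open>w \<mapsto> \<bar>w\<bar>\<^sup>2\<close>. This replaces polar coordinates.\<close>

lemma nn_integral_disc_circle_mean:
  fixes f :: "complex \<Rightarrow> real" and \<Psi> :: "real \<Rightarrow> real"
  assumes f: "f \<in> borel_measurable disc_measure" and nonneg: "\<And>w. w \<in> disc \<Longrightarrow> 0 \<le> f w"
    and \<Psi>: "continuous_on {0..<1} \<Psi>"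
    and mean: "\<And>w. w \<in> disc \<Longrightarrow> ((\<lambda>t. f (cis (2 * pi * t) * w)) has_integral \<Psi> ((norm w)\<^sup>2)) {0..1}"
  shows "(\<integral>\<^sup>+w. ennreal (f w) \<partial>disc_measure)
      = ennreal pi * (\<integral>\<^sup>+s. ennreal (\<Psi> s) * indicator {0..<1} s \<partial>lborel)"
proof -
  interpret T: finite_measure unit_interval_measure by (rule finite_measure_unit_interval)
  interpret D: finite_measure disc_measure by (rule finite_measure_disc)
  interpret TD: pair_sigma_finite unit_interval_measure disc_measure ..
  note f [measurable]
  have [measurable]: "(\<lambda>(t, w). ennreal (f (cis (2 * pi * t) * w)))
      \<in> borel_measurable (unit_interval_measure \<Otimes>\<^sub>M disc_measure)"
    using measurable_compose[OF cis_mult_measurable f] by (simp add: case_prod_unfold)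
  have rot: "(\<integral>\<^sup>+w. ennreal (f (c * w)) \<partial>disc_measure) = (\<integral>\<^sup>+w. ennreal (f w) \<partial>disc_measure)"
    if "norm c = 1" for c
  proof -
    have "(\<integral>\<^sup>+w. ennreal (f w) \<partial>distr disc_measure disc_measure ((*) c))
        = (\<integral>\<^sup>+w. ennreal (f (c * w)) \<partial>disc_measure)"
      using that by (intro nn_integral_distr measurable_restrict_space3) (auto simp: rotate_disc_iff)
    then show ?thesis
      using that by (simp add: distr_rotate_disc)
  qed
  \<comment> \<open>The circle mean is controlled only on \<open>{0..<1}\<close>; extension by zero
    makes it Borel on the whole line, as the push-forward requires.\<close>
  define \<Psi>' where "\<Psi>' = (\<lambda>s. indicator {0..<1} s *\<^sub>R \<Psi> s)"
  have [measurable]: "\<Psi>' \<in> borel_measurable borel"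
    unfolding \<Psi>'_def using \<Psi> by (intro borel_measurable_continuous_on_indicator) auto
  have [measurable]: "(\<lambda>w. (norm w)\<^sup>2) \<in> borel_measurable disc_measure"
    by (intro measurable_disc_continuous continuous_intros)
  \<comment> \<open>Rotations preserve the disc measure, so the inner integral is the same for every
    \<open>t\<close>, and the interval of angles has mass 1.\<close>
  have "(\<integral>\<^sup>+w. ennreal (f w) \<partial>disc_measure)
      = (\<integral>\<^sup>+t. \<integral>\<^sup>+w. ennreal (f (cis (2 * pi * t) * w)) \<partial>disc_measure \<partial>unit_interval_measure)"
    by (simp add: rot emeasure_unit_interval space_restrict_space)
  also have "\<dots> = (\<integral>\<^sup>+w. \<integral>\<^sup>+t. ennreal (f (cis (2 * pi * t) * w)) \<partial>unit_interval_measure \<partial>disc_measure)"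
    by (rule TD.Fubini'[symmetric]) simp
  also have "\<dots> = (\<integral>\<^sup>+w. ennreal (\<Psi>' ((norm w)\<^sup>2)) \<partial>disc_measure)"
  proof (rule nn_integral_cong)
    fix w assume "w \<in> space disc_measure"
    then have w: "w \<in> disc" by simp
    then have "(norm w)\<^sup>2 < 1" by (simp add: disc_def abs_square_less_1)
    then show "(\<integral>\<^sup>+t. ennreal (f (cis (2 * pi * t) * w)) \<partial>unit_interval_measure) = ennreal (\<Psi>' ((norm w)\<^sup>2))"
      using mean[OF w] nonneg w by (subst nn_integral_unit_interval_measure) (auto simp: \<Psi>'_def rotate_disc_iff)
  qed
  also have "\<dots> = (\<integral>\<^sup>+s. ennreal (\<Psi>' s) \<partial>distr disc_measure borel (\<lambda>w. (norm w)\<^sup>2))"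
    by (subst nn_integral_distr) auto
  also have "\<dots> = (\<integral>\<^sup>+s. ennreal pi * (ennreal (\<Psi> s) * indicator {0..<1} s) \<partial>lborel)"
    unfolding distr_norm_square_disc
    by (subst nn_integral_density, simp, simp)
      (auto intro!: nn_integral_cong simp: \<Psi>'_def split: split_indicator)
  also have "\<dots> = ennreal pi * (\<integral>\<^sup>+s. ennreal (\<Psi> s) * indicator {0..<1} s \<partial>lborel)"
  proof (rule nn_integral_cmult)
    have "(\<lambda>s. ennreal (\<Psi> s) * indicator {0..<1} s) = (\<lambda>s. ennreal (\<Psi>' s))"
      by (auto simp: \<Psi>'_def split: split_indicator)
    then show "(\<lambda>s. ennreal (\<Psi> s) * indicator {0..<1} s) \<in> borel_measurable lborel"
      by simp
  qed
  finally show ?thesis .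
qed

text \<open>For complex values Fubini's theorem needs absolute integrability on the product, which
  rotation invariance reduces to integrability of \<open>f\<close>. Continuity of \<open>f\<close>
  makes the gauge integral over each circle a Lebesgue integral.\<close>

lemma integral_disc_circle_mean:
  fixes f :: "complex \<Rightarrow> complex" and \<Psi> :: "real \<Rightarrow> complex"
  assumes f: "integrable disc_measure f" and cont: "continuous_on disc f"
    and \<Psi>: "continuous_on {0..<1} \<Psi>"
    and mean: "\<And>w. w \<in> disc \<Longrightarrow> ((\<lambda>t. f (cis (2 * pi * t) * w)) has_integral \<Psi> ((norm w)\<^sup>2)) {0..1}"
  shows "(LINT w|disc_measure. f w) = of_real pi * (LINT s:{0..<1}|lborel. \<Psi> s)"
proof -
  interpret T: finite_measure unit_interval_measure by (rule finite_measure_unit_interval)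
  interpret D: finite_measure disc_measure by (rule finite_measure_disc)
  interpret TD: pair_sigma_finite unit_interval_measure disc_measure ..
  have fm [measurable]: "f \<in> borel_measurable disc_measure"
    using f by simp
  have rot_m: "(*) c \<in> disc_measure \<rightarrow>\<^sub>M disc_measure" if "norm c = 1" for c
    using that by (intro measurable_restrict_space3) (auto simp: rotate_disc_iff)
  have rot: "(LINT w|disc_measure. g (c * w)) = (LINT w|disc_measure. g w)"
    if "norm c = 1" and [measurable]: "g \<in> borel_measurable disc_measure"
    for c and g :: "complex \<Rightarrow> 'a :: {banach, second_countable_topology}"
    using integral_distr[OF rot_m[OF that(1)], of g] that by (simp add: distr_rotate_disc)
  have rot_int: "integrable disc_measure (\<lambda>w. f (c * w))" if "norm c = 1" for c
    using integrable_distr_eq[OF rot_m[OF that], of f] that f by (simp add: distr_rotate_disc)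
  have int: "integrable (unit_interval_measure \<Otimes>\<^sub>M disc_measure) (\<lambda>(t, w). f (cis (2 * pi * t) * w))"
  proof (rule TD.Fubini_integrable)
    show "(\<lambda>(t, w). f (cis (2 * pi * t) * w)) \<in> borel_measurable (unit_interval_measure \<Otimes>\<^sub>M disc_measure)"
      using measurable_compose[OF cis_mult_measurable fm] by (simp add: case_prod_unfold)
    show "integrable unit_interval_measure
       (\<lambda>t. LINT w|disc_measure. norm (case (t, w) of (t, w) \<Rightarrow> f (cis (2 * pi * t) * w)))"
      using rot[of "cis (2 * pi * _)" "\<lambda>w. norm (f w)"] by simp
    show "AE t in unit_interval_measure.
        integrable disc_measure (\<lambda>w. case (t, w) of (t, w) \<Rightarrow> f (cis (2 * pi * t) * w))"
      by (simp add: rot_int)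
  qed
  define \<Psi>' where "\<Psi>' = (\<lambda>s. indicator {0..<1} s *\<^sub>R \<Psi> s)"
  have [measurable]: "\<Psi>' \<in> borel_measurable borel"
    unfolding \<Psi>'_def using \<Psi> by (intro borel_measurable_continuous_on_indicator) auto
  have [measurable]: "(\<lambda>w. (norm w)\<^sup>2) \<in> borel_measurable disc_measure"
    by (intro measurable_disc_continuous continuous_intros)
  have "(LINT w|disc_measure. f w)
      = (LINT t|unit_interval_measure. LINT w|disc_measure. f (cis (2 * pi * t) * w))"
    by (simp add: rot measure_def emeasure_unit_interval space_restrict_space)
  also have "\<dots> = (LINT w|disc_measure. LINT t|unit_interval_measure. f (cis (2 * pi * t) * w))"
    by (rule TD.Fubini_integral[symmetric]) (use int in simp)
  also have "\<dots> = (LINT w|disc_measure. \<Psi>' ((norm w)\<^sup>2))"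
  proof (rule Bochner_Integration.integral_cong)
    fix w assume "w \<in> space disc_measure"
    then have w: "w \<in> disc" by simp
    then have "(norm w)\<^sup>2 < 1" by (simp add: disc_def abs_square_less_1)
    moreover have "continuous_on {0..1} (\<lambda>t. f (cis (2 * pi * t) * w))"
      using w by (intro continuous_on_compose2[OF cont] continuous_intros) (auto simp: rotate_disc_iff)
    ultimately show "(LINT t|unit_interval_measure. f (cis (2 * pi * t) * w)) = \<Psi>' ((norm w)\<^sup>2)"
      using mean[OF w] by (subst has_integral_unit_interval_measure) (auto simp: \<Psi>'_def)
  qed simp
  also have "\<dots> = (LINT s|distr disc_measure borel (\<lambda>w. (norm w)\<^sup>2). \<Psi>' s)"
    by (subst integral_distr) auto
  also have "\<dots> = (LINT s|density lborel (\<lambda>s. ennreal (pi * indicator {0..<1} s)). \<Psi>' s)"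
    unfolding distr_norm_square_disc
    by (intro arg_cong2[where f="integral\<^sup>L"] arg_cong2[where f=density])
      (auto simp: ennreal_mult' ennreal_indicator)
  also have "\<dots> = (LINT s|lborel. (pi * indicator {0..<1} s) *\<^sub>R \<Psi>' s)"
    by (subst integral_density) auto
  also have "\<dots> = (LINT s|lborel. pi *\<^sub>R (indicator {0..<1} s *\<^sub>R \<Psi> s))"
    by (intro Bochner_Integration.integral_cong) (auto simp: \<Psi>'_def split: split_indicator)
  also have "\<dots> = of_real pi * (LINT s:{0..<1}|lborel. \<Psi> s)"
    by (simp add: set_lebesgue_integral_def scaleR_conv_of_real)
  finally show ?thesis .
qed

section \<open>Kernel estimates and the reproducing formula\<close>

text \<open>Parametrising the unit circle by \<open>v = cis (2 * pi * t)\<close> gives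
  \<open>dv = 2 * pi * \<i> * v dt\<close>: this is the extra factor \<open>cis\<close> in the
  numerator, and the constant cancels the one in Cauchy's formula. Circle means are computed by
  bringing their integrands into this shape.\<close>

lemma has_integral_circle_Cauchy:
  assumes "continuous_on (cball 0 1) g" "g holomorphic_on ball 0 1" "norm c < 1"
  shows "((\<lambda>t. g (cis (2 * pi * t)) * cis (2 * pi * t) / (cis (2 * pi * t) - c) ^ Suc n)
    has_integral (deriv ^^ n) g c / fact n) {0..1}"
proof -
  have circ: "circlepath 0 1 t = cis (2 * pi * t)" for t
    by (simp add: circlepath cis_conv_exp mult_ac)
  have "((\<lambda>u. g u / (u - c) ^ Suc n) has_contour_integral (2 * pi * \<i>) / fact n * (deriv ^^ n) g c)
      (circlepath 0 1)"
    using assms by (intro Cauchy_has_contour_integral_higher_derivative_circlepath) auto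
  then have "((\<lambda>t. g (cis (2 * pi * t)) / (cis (2 * pi * t) - c) ^ Suc n * (2 * pi * \<i> * cis (2 * pi * t)))
      has_integral (2 * pi * \<i>) / fact n * (deriv ^^ n) g c) {0..1}"
    unfolding has_contour_integral_def
    by (rule has_integral_eq[rotated])
      (simp add: circ vector_derivative_circlepath01 cis_conv_exp mult_ac)
  from has_integral_divide[OF this, of "2 * pi * \<i>"] show ?thesis
    by (simp add: mult_ac)
qed

lemma has_integral_Re:
  "(f has_integral I) S \<Longrightarrow> ((\<lambda>x. Re (f x)) has_integral Re I) S"
  using has_integral_linear[OF _ bounded_linear_Re] by (simp add: o_def)

text \<open>On the unit circle \<open>cnj v = 1 / v\<close>, so \<open>|1 - u v|^2\<close> becomes a
  rational function of \<open>v\<close>. For \<open>|u| < 1\<close> the factor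
  \<open>1 - u v\<close> has no zero in the closed disc, and \<open>v - cnj u\<close> vanishes at
  \<open>cnj u\<close>, the point at which Cauchy's formula is evaluated below.\<close>

lemma norm_one_minus_mult_cis:
  "of_real ((norm (1 - u * cis t))\<^sup>2) = (1 - u * cis t) * (cis t - cnj u) / cis t"
proof -
  have "of_real ((norm (1 - u * cis t))\<^sup>2) = (1 - u * cis t) * cnj (1 - u * cis t)"
    by (rule complex_norm_square)
  also have "cnj (1 - u * cis t) = (cis t - cnj u) / cis t"
    by (simp add: cis_cnj divide_inverse left_diff_distrib cis_mult)
  finally show ?thesis by simp
qed

lemma one_minus_mult_nonzero:
  fixes u v :: complex
  assumes "norm u < 1" "norm v \<le> 1"
  shows "1 - u * v \<noteq> 0"
proof
  assume "1 - u * v = 0"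
  then have "norm (u * v) = 1" by simp
  moreover have "norm (u * v) \<le> norm u"
    using assms by (simp add: norm_mult mult_left_le)
  ultimately show False using assms by simp
qed

lemma circle_mean_inverse_power2:
  assumes u: "norm u < 1"
  shows "((\<lambda>t. 1 / (norm (1 - u * cis (2 * pi * t)))\<^sup>2) has_integral 1 / (1 - (norm u)\<^sup>2)) {0..1}"
proof -
  let ?g = "\<lambda>v. 1 / (1 - u * v)"
  have "((\<lambda>t. ?g (cis (2 * pi * t)) * cis (2 * pi * t) / (cis (2 * pi * t) - cnj u) ^ Suc 0)
      has_integral (deriv ^^ 0) ?g (cnj u) / fact 0) {0..1}"
    using u one_minus_mult_nonzero[OF u]
    by (intro has_integral_circle_Cauchy continuous_intros holomorphic_intros) auto
  moreover have "?g (cnj u) = of_real (1 / (1 - (norm u)\<^sup>2))"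
    using complex_norm_square[of u] by simp
  ultimately have "((\<lambda>t. ?g (cis (2 * pi * t)) * cis (2 * pi * t) / (cis (2 * pi * t) - cnj u))
      has_integral of_real (1 / (1 - (norm u)\<^sup>2))) {0..1}"
    by simp
  from has_integral_Re[OF this]
  have "((\<lambda>t. Re (?g (cis (2 * pi * t)) * cis (2 * pi * t) / (cis (2 * pi * t) - cnj u)))
      has_integral 1 / (1 - (norm u)\<^sup>2)) {0..1}"
    by simp
  then show ?thesis
  proof (rule has_integral_eq[rotated])
    fix t
    have "?g (cis (2 * pi * t)) * cis (2 * pi * t) / (cis (2 * pi * t) - cnj u)
        = 1 / of_real ((norm (1 - u * cis (2 * pi * t)))\<^sup>2)"
      unfolding norm_one_minus_mult_cis by simp
    also have "\<dots> = of_real (1 / (norm (1 - u * cis (2 * pi * t)))\<^sup>2)"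
      by simp
    finally show "Re (?g (cis (2 * pi * t)) * cis (2 * pi * t) / (cis (2 * pi * t) - cnj u))
        = 1 / (norm (1 - u * cis (2 * pi * t)))\<^sup>2"
      by (simp only: Re_complex_of_real)
  qed
qed

text \<open>Squaring the rational form leaves \<open>(v - cnj u)^2\<close> in the denominator, so
  Cauchy's formula is used with one derivative, applied to \<open>v / (1 - u v)^2\<close>.\<close>

lemma circle_mean_inverse_power4:
  assumes u: "norm u < 1"
  shows "((\<lambda>t. 1 / (norm (1 - u * cis (2 * pi * t))) ^ 4)
    has_integral (1 + (norm u)\<^sup>2) / (1 - (norm u)\<^sup>2) ^ 3) {0..1}"
proof -
  let ?g = "\<lambda>v. v / (1 - u * v)\<^sup>2"
  have "((\<lambda>t. ?g (cis (2 * pi * t)) * cis (2 * pi * t) / (cis (2 * pi * t) - cnj u) ^ Suc 1)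
      has_integral (deriv ^^ 1) ?g (cnj u) / fact 1) {0..1}"
    using u one_minus_mult_nonzero[OF u]
    by (intro has_integral_circle_Cauchy continuous_intros holomorphic_intros) auto
  moreover have "deriv ?g (cnj u) = of_real ((1 + (norm u)\<^sup>2) / (1 - (norm u)\<^sup>2) ^ 3)"
  proof (rule DERIV_imp_deriv)
    have nz: "1 - u * cnj u \<noteq> 0"
      using one_minus_mult_nonzero[OF u, of "cnj u"] u by simp
    then have nz': "u * cnj u \<noteq> 1" by simp
    have "(?g has_field_derivative (1 * (1 - u * cnj u)\<^sup>2 - cnj u * (2 * (1 - u * cnj u) * - u))
        / ((1 - u * cnj u)\<^sup>2 * (1 - u * cnj u)\<^sup>2)) (at (cnj u))"
      by (auto intro!: derivative_eq_intros simp: nz')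
    also have "(1 * (1 - u * cnj u)\<^sup>2 - cnj u * (2 * (1 - u * cnj u) * - u))
        / ((1 - u * cnj u)\<^sup>2 * (1 - u * cnj u)\<^sup>2)
        = ((1 - u * cnj u)\<^sup>2 + 2 * u * cnj u * (1 - u * cnj u)) / (1 - u * cnj u) ^ 4"
      by (simp add: power2_eq_square power4_eq_xxxx mult_ac)
    also have "((1 - u * cnj u)\<^sup>2 + 2 * u * cnj u * (1 - u * cnj u)) / (1 - u * cnj u) ^ 4
        = (1 + u * cnj u) / (1 - u * cnj u) ^ 3"
      using nz by (simp add: divide_simps) (simp add: power2_eq_square power3_eq_cube power4_eq_xxxx algebra_simps)
    also have "\<dots> = of_real ((1 + (norm u)\<^sup>2) / (1 - (norm u)\<^sup>2) ^ 3)"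
      using complex_norm_square[of u] by simp
    finally show "(?g has_field_derivative of_real ((1 + (norm u)\<^sup>2) / (1 - (norm u)\<^sup>2) ^ 3)) (at (cnj u))" .
  qed
  ultimately have "((\<lambda>t. ?g (cis (2 * pi * t)) * cis (2 * pi * t) / (cis (2 * pi * t) - cnj u)\<^sup>2)
      has_integral of_real ((1 + (norm u)\<^sup>2) / (1 - (norm u)\<^sup>2) ^ 3)) {0..1}"
    by (simp add: numeral_2_eq_2)
  from has_integral_Re[OF this]
  have "((\<lambda>t. Re (?g (cis (2 * pi * t)) * cis (2 * pi * t) / (cis (2 * pi * t) - cnj u)\<^sup>2))
      has_integral (1 + (norm u)\<^sup>2) / (1 - (norm u)\<^sup>2) ^ 3) {0..1}"
    by (simp only: Re_complex_of_real)
  then show ?thesis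
  proof (rule has_integral_eq[rotated])
    fix t
    have "?g (cis (2 * pi * t)) * cis (2 * pi * t) / (cis (2 * pi * t) - cnj u)\<^sup>2
        = 1 / (of_real ((norm (1 - u * cis (2 * pi * t)))\<^sup>2))\<^sup>2"
      unfolding norm_one_minus_mult_cis by (simp add: power2_eq_square)
    also have "\<dots> = of_real (1 / norm (1 - u * cis (2 * pi * t)) ^ 4)"
      by (simp flip: power_mult)
    finally show "Re (?g (cis (2 * pi * t)) * cis (2 * pi * t) / (cis (2 * pi * t) - cnj u)\<^sup>2)
        = 1 / norm (1 - u * cis (2 * pi * t)) ^ 4"
      by (simp only: Re_complex_of_real)
  qed
qed

lemma norm_rotated_kernel:
  "norm (1 - z * cnj (cis t * w)) = norm (1 - cnj z * w * cis t)"
proof -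
  have "1 - cnj z * w * cis t = cnj (1 - z * cnj (cis t * w))"
    by (simp add: mult_ac)
  then show ?thesis by (simp only: complex_mod_cnj)
qed

section \<open>Area integrals of powers of the kernel\<close>

lemma norm_kernel_ge:
  assumes "w \<in> disc"
  shows "1 - norm z \<le> norm (1 - z * cnj w)"
proof -
  have "norm (z * cnj w) \<le> norm z"
    using assms by (simp add: norm_mult disc_def mult_left_le)
  then show ?thesis
    using norm_triangle_ineq2[of 1 "z * cnj w"] by simp
qed

lemma norm_mult_disc_less:
  assumes "z \<in> disc" "w \<in> disc"
  shows "norm (z * w) < 1"
  using assms mult_strict_mono'[of "norm z" 1 "norm w" 1] by (simp add: disc_def norm_mult)

lemma kernel_nonzero: "z \<in> disc \<Longrightarrow> w \<in> disc \<Longrightarrow> 1 - z * cnj w \<noteq> 0"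
  using one_minus_mult_nonzero[of z "cnj w"] by (simp add: disc_def)

text \<open>By AM-GM, \<open>x^3 \<le> (\<lambda> x^2 + x^4 / \<lambda>) / 2\<close>; the choice \<open>\<lambda> = 1 / (1 - \<bar>z w\<bar>\<^sup>2)\<close> makes the
  circle means of both terms comparable.\<close>

lemma nn_integral_kernel_power3:
  assumes z: "z \<in> disc"
  shows "(\<integral>\<^sup>+w. ennreal (1 / norm (1 - z * cnj w) ^ 3) \<partial>disc_measure)
    \<le> ennreal (3 / 2 * pi / (1 - (norm z)\<^sup>2))"
proof -
  define r where "r = (norm z)\<^sup>2"
  have r: "0 \<le> r" "r < 1"
    using z by (auto simp: r_def disc_def abs_square_less_1)
  have rs: "r * s < 1" if "0 \<le> s" "s \<le> 1" for s
    using mult_left_le[of s r] r that by linarith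
  define f where "f = (\<lambda>w. (1 / (1 - r * (norm w)\<^sup>2) * (1 / (norm (1 - z * cnj w))\<^sup>2)
      + (1 - r * (norm w)\<^sup>2) * (1 / norm (1 - z * cnj w) ^ 4)) / 2)"
  define \<Psi> where "\<Psi> = (\<lambda>s. (1 / (1 - r * s) * (1 / (1 - r * s)) + (1 - r * s) * ((1 + r * s) / (1 - r * s) ^ 3)) / 2)"
  have rw: "r * (norm w)\<^sup>2 < 1" if "w \<in> disc" for w
    using that by (intro rs) (auto simp: disc_def abs_square_less_1 less_imp_le)
  have le: "1 / norm (1 - z * cnj w) ^ 3 \<le> f w" if "w \<in> disc" for w
  proof -
    define x where "x = 1 / norm (1 - z * cnj w)"
    define l where "l = 1 - r * (norm w)\<^sup>2"
    have l: "l > 0" using rw[OF that] by (simp add: l_def)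
    \<comment> \<open>The gap in the AM-GM inequality is a perfect square. Here \<open>l\<close> is
      the reciprocal of the parameter; it is constant on circles and so commutes with the circle
      mean.\<close>
    have "f w - x ^ 3 = x\<^sup>2 / (2 * l) * (1 - l * x)\<^sup>2"
      using l by (simp add: f_def x_def[symmetric] l_def[symmetric] power_one_over[symmetric])
        (simp add: field_simps power2_eq_square power3_eq_cube power4_eq_xxxx)
    moreover have "\<dots> \<ge> 0" using l by simp
    ultimately show ?thesis by (simp add: x_def power_one_over)
  qed
  have "(\<integral>\<^sup>+w. ennreal (1 / norm (1 - z * cnj w) ^ 3) \<partial>disc_measure) \<le> (\<integral>\<^sup>+w. ennreal (f w) \<partial>disc_measure)"
    using le by (intro nn_integral_mono ennreal_leI) simp
  also have "\<dots> = ennreal pi * (\<integral>\<^sup>+s. ennreal (\<Psi> s) * indicator {0..<1} s \<partial>lborel)"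
  proof (rule nn_integral_disc_circle_mean)
    show "f \<in> borel_measurable disc_measure"
      unfolding f_def using rw kernel_nonzero[OF z]
      by (intro measurable_disc_continuous continuous_intros) force+
    show "0 \<le> f w" if "w \<in> disc" for w
      using le[OF that] by (rule order_trans[rotated]) simp
    show "continuous_on {0..<1} \<Psi>"
      unfolding \<Psi>_def using rs by (intro continuous_intros) force+
    fix w assume w: "w \<in> disc"
    have u: "norm (cnj z * w) < 1"
      using norm_mult_disc_less[of "cnj z" w] z w by (simp add: disc_def)
    have nu: "(norm (cnj z * w))\<^sup>2 = r * (norm w)\<^sup>2"
      by (simp add: norm_mult r_def power_mult_distrib)
    have f_rot: "f (cis (2 * pi * t) * w)
        = (1 / (1 - r * (norm w)\<^sup>2) * (1 / (norm (1 - cnj z * w * cis (2 * pi * t)))\<^sup>2)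
        + (1 - r * (norm w)\<^sup>2) * (1 / norm (1 - cnj z * w * cis (2 * pi * t)) ^ 4)) / 2" for t
      unfolding f_def norm_rotated_kernel by (simp add: norm_mult)
    show "((\<lambda>t. f (cis (2 * pi * t) * w)) has_integral \<Psi> ((norm w)\<^sup>2)) {0..1}"
      unfolding f_rot \<Psi>_def
      using circle_mean_inverse_power2[OF u] circle_mean_inverse_power4[OF u] unfolding nu
      by (intro has_integral_divide has_integral_add has_integral_mult_right)
  qed
  finally have *: "(\<integral>\<^sup>+w. ennreal (1 / norm (1 - z * cnj w) ^ 3) \<partial>disc_measure)
      \<le> ennreal pi * (\<integral>\<^sup>+s. ennreal (\<Psi> s) * indicator {0..<1} s \<partial>lborel)" .
  have "(\<integral>\<^sup>+s. ennreal (\<Psi> s) * indicator {0..<1} s \<partial>lborel)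
      \<le> (\<integral>\<^sup>+s. ennreal (3 / 2 / (1 - r * s)\<^sup>2) * indicator {0..1} s \<partial>lborel)"
  proof (intro nn_integral_mono)
    fix s :: real
    show "ennreal (\<Psi> s) * indicator {0..<1} s \<le> ennreal (3 / 2 / (1 - r * s)\<^sup>2) * indicator {0..1} s"
    proof (cases "s \<in> {0..<1}")
      case True
      then have "r * s < 1" by (intro rs) auto
      \<comment> \<open>Both means become multiples of \<open>1 / (1 - r * s)^2\<close>; the
        numerator \<open>2 + r * s\<close> is at most 3, which is the origin of the constant
        3/2.\<close>
      then have "\<Psi> s = (2 + r * s) / 2 / (1 - r * s)\<^sup>2"
        by (simp add: \<Psi>_def divide_simps) (simp add: power2_eq_square power3_eq_cube algebra_simps)
      also have "\<dots> \<le> 3 / 2 / (1 - r * s)\<^sup>2"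
        using \<open>r * s < 1\<close> by (intro divide_right_mono) auto
      finally show ?thesis using True by (auto intro: ennreal_leI)
    qed simp
  qed
  \<comment> \<open>The primitive \<open>s / (1 - r * s)\<close> is normalised to vanish at 0, so
    that \<open>r = 0\<close>, that is \<open>z = 0\<close>, needs no separate case.\<close>
  also have "\<dots> = ennreal (3 / 2 * (1 / (1 - r * 1)) - 3 / 2 * (0 / (1 - r * 0)))"
  proof (rule nn_integral_FTC_Icc[where F="\<lambda>s. 3 / 2 * (s / (1 - r * s))"])
    show "(\<lambda>s. 3 / 2 / (1 - r * s)\<^sup>2) \<in> borel_measurable borel" by measurable
    fix s :: real assume "s \<in> {0..1}"
    then have s: "0 \<le> s" "s \<le> 1" by auto
    show "((\<lambda>s. 3 / 2 * (s / (1 - r * s))) has_real_derivative 3 / 2 / (1 - r * s)\<^sup>2) (at s)"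
    proof -
      have "((\<lambda>s. s / (1 - r * s)) has_real_derivative
          (1 * (1 - r * s) - s * (- r)) / ((1 - r * s) * (1 - r * s))) (at s)"
        using rs[OF s] by (auto intro!: derivative_eq_intros)
      from DERIV_cmult[OF this, of "3 / 2"] show ?thesis
        by (simp add: power2_eq_square mult_ac)
    qed
  qed auto
  finally have "ennreal pi * (\<integral>\<^sup>+s. ennreal (\<Psi> s) * indicator {0..<1} s \<partial>lborel)
      \<le> ennreal pi * ennreal (3 / 2 * (1 / (1 - r * 1)) - 3 / 2 * (0 / (1 - r * 0)))"
    by (rule mult_left_mono) simp
  also have "\<dots> = ennreal (3 / 2 * pi / (1 - r))"
    using r by (subst ennreal_mult'[symmetric]) (auto simp: mult_ac)
  finally show ?thesis
    using * by (simp add: r_def)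
qed

text \<open>The integral is split at \<open>s = r\<close>. Below \<open>r\<close> one uses
  \<open>1 - r * s \<ge> 1 - s\<close>, above \<open>r\<close> one uses
  \<open>1 - r * s \<ge> 1 - r\<close>; both pieces are of order \<open>(1 - r) powr - a\<close>.
  The first costs \<open>1 / a\<close>, the second \<open>1 / (1 - a)\<close>, and
  \<open>a < 1\<close> makes the singularity at 1 integrable.\<close>

lemma nn_integral_radial_kernel:
  fixes a r :: real
  assumes a: "0 < a" "a < 1" and r: "0 \<le> r" "r < 1"
  shows "(\<integral>\<^sup>+s. ennreal (1 / (1 - r * s) * (1 - s) powr - a) * indicator {0..<1} s \<partial>lborel)
    \<le> ennreal ((1 / a + 1 / (1 - a)) * (1 - r) powr - a)"
proof -
  define g1 g2 where "g1 = (\<lambda>s::real. (1 - s) powr (- a - 1))" and "g2 = (\<lambda>s::real. (1 - s) powr - a / (1 - r))"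
  have le: "ennreal (1 / (1 - r * s) * (1 - s) powr - a) * indicator {0..<1} s
      \<le> ennreal (g1 s) * indicator {0..r} s + ennreal (indicator {r..1} s * g2 s)" for s
  proof (cases "s \<in> {0..<1}")
    case True
    then have "r * s \<le> r * 1" "r * s \<le> 1 * s" using r by (intro mult_mono; simp)+
    then have *: "r * s \<le> r" "r * s \<le> s" by auto
    show ?thesis
    proof (cases "s \<le> r")
      case s: True
      have "1 / (1 - r * s) * (1 - s) powr - a \<le> 1 / (1 - s) * (1 - s) powr - a"
        using * True by (intro mult_right_mono divide_left_mono mult_pos_pos) auto
      also have "\<dots> = g1 s"
        using True by (simp add: g1_def powr_diff)
      finally have "ennreal (1 / (1 - r * s) * (1 - s) powr - a) \<le> ennreal (g1 s)"
        by (rule ennreal_leI)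
      then show ?thesis
        using True s by (simp add: add_increasing2)
    next
      case False
      have "1 / (1 - r * s) * (1 - s) powr - a \<le> 1 / (1 - r) * (1 - s) powr - a"
        using * True r by (intro mult_right_mono divide_left_mono mult_pos_pos) auto
      also have "\<dots> = g2 s"
        by (simp add: g2_def)
      finally have "ennreal (1 / (1 - r * s) * (1 - s) powr - a) \<le> ennreal (g2 s)"
        by (rule ennreal_leI)
      then show ?thesis
        using True False by simp
    qed
  qed simp
  have g1: "(\<integral>\<^sup>+s. ennreal (g1 s) * indicator {0..r} s \<partial>lborel) = ennreal ((1 - r) powr - a / a - (1 - 0) powr - a / a)"
  proof (rule nn_integral_FTC_Icc[where F="\<lambda>s. (1 - s) powr - a / a"])
    show "g1 \<in> borel_measurable borel" unfolding g1_def by measurable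
    fix s assume "s \<in> {0..r}"
    then show "((\<lambda>s. (1 - s) powr - a / a) has_real_derivative g1 s) (at s)"
      using a r by (auto intro!: derivative_eq_intros simp: g1_def powr_diff)
  qed (use r in \<open>auto simp: g1_def\<close>)
  \<comment> \<open>The integrand is singular at 1, so the fundamental theorem is used in the form
    that asks for derivatives only inside the interval; \<open>a < 1\<close> keeps the primitive
    continuous at the endpoint.\<close>
  have "(g2 has_integral (- ((1 - 1) powr (1 - a)) / (1 - a) / (1 - r)) - (- ((1 - r) powr (1 - a)) / (1 - a) / (1 - r))) {r..1}"
  proof (rule fundamental_theorem_of_calculus_interior)
    show "continuous_on {r..1} (\<lambda>s. - ((1 - s) powr (1 - a)) / (1 - a) / (1 - r))"
      using a r by (intro continuous_intros continuous_on_powr') auto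
    fix s assume s: "s \<in> {r<..<1}"
    have "((\<lambda>s. (1 - s) powr (1 - a)) has_real_derivative (1 - a) * (1 - s) powr (1 - a - 1) * (- 1)) (at s)"
      using s by (auto intro!: derivative_eq_intros)
    from DERIV_cdivide[OF DERIV_cdivide[OF DERIV_minus[OF this], of "1 - a"], of "1 - r"]
    have "((\<lambda>s. - ((1 - s) powr (1 - a)) / (1 - a) / (1 - r)) has_real_derivative g2 s) (at s)"
      using a by (simp add: g2_def)
    then show "((\<lambda>s. - ((1 - s) powr (1 - a)) / (1 - a) / (1 - r)) has_vector_derivative g2 s) (at s)"
      by (simp add: has_real_derivative_iff_has_vector_derivative)
  qed (use r in auto)
  moreover have "(1 - r) powr (1 - a) / (1 - r) = (1 - r) powr - a"
    using r by (simp add: powr_diff powr_minus divide_inverse)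
  moreover have "x / (1 - a) / (1 - r) = x / (1 - r) / (1 - a)" for x
    by (simp add: mult.commute)
  ultimately have "(g2 has_integral (1 - r) powr - a / (1 - a)) {r..1}"
    by (simp del: divide_divide_eq_left)
  then have g2: "(\<integral>\<^sup>+s. ennreal (indicator {r..1} s * g2 s) \<partial>lborel) = ennreal ((1 - r) powr - a / (1 - a))"
    using r by (intro nn_integral_has_integral_lebesgue) (auto simp: g2_def)
  have [measurable]: "g1 \<in> borel_measurable borel" "g2 \<in> borel_measurable borel"
    unfolding g1_def g2_def by measurable
  have "(\<integral>\<^sup>+s. ennreal (1 / (1 - r * s) * (1 - s) powr - a) * indicator {0..<1} s \<partial>lborel)
      \<le> (\<integral>\<^sup>+s. ennreal (g1 s) * indicator {0..r} s + ennreal (indicator {r..1} s * g2 s) \<partial>lborel)"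
    by (intro nn_integral_mono le)
  also have "\<dots> = ennreal ((1 - r) powr - a / a - (1 - 0) powr - a / a) + ennreal ((1 - r) powr - a / (1 - a))"
    unfolding g1[symmetric] g2[symmetric] by (rule nn_integral_add) measurable
  also have "\<dots> \<le> ennreal ((1 - r) powr - a / a) + ennreal ((1 - r) powr - a / (1 - a))"
    using a by (intro add_mono ennreal_leI) auto
  also have "\<dots> = ennreal ((1 / a + 1 / (1 - a)) * (1 - r) powr - a)"
    using a by (subst ennreal_plus[symmetric]) (auto simp: field_simps)
  finally show ?thesis .
qed

text \<open>The weight is constant on circles, so averaging replaces the squared kernel by
  \<open>1 / (1 - r * s)\<close> and the radial estimate applies. For Schur's test this means that
  the positive kernel \<open>|1 - z cnj w|^(-2)\<close> maps the weight
  \<open>(1 - |w|^2)^(-a)\<close> to at most a constant multiple of itself.\<close>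

lemma nn_integral_kernel_power2:
  assumes z: "z \<in> disc" and a: "0 < a" "a < 1"
  shows "(\<integral>\<^sup>+w. ennreal (1 / (norm (1 - z * cnj w))\<^sup>2 * (1 - (norm w)\<^sup>2) powr - a) \<partial>disc_measure)
    \<le> ennreal (pi * (1 / a + 1 / (1 - a)) * (1 - (norm z)\<^sup>2) powr - a)"
proof -
  define r where "r = (norm z)\<^sup>2"
  have r: "0 \<le> r" "r < 1"
    using z by (auto simp: r_def disc_def abs_square_less_1)
  have rs: "r * s < 1" if "0 \<le> s" "s < 1" for s
    using mult_left_le[of s r] r that by linarith
  define f where "f = (\<lambda>w. 1 / (norm (1 - z * cnj w))\<^sup>2 * (1 - (norm w)\<^sup>2) powr - a)"
  have "(\<integral>\<^sup>+w. ennreal (f w) \<partial>disc_measure)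
      = ennreal pi * (\<integral>\<^sup>+s. ennreal (1 / (1 - r * s) * (1 - s) powr - a) * indicator {0..<1} s \<partial>lborel)"
  proof (rule nn_integral_disc_circle_mean)
    have "(norm w)\<^sup>2 \<noteq> 1" if "w \<in> disc" for w
      using that by (simp add: disc_def power2_eq_1_iff) (smt (verit) norm_ge_zero)
    then show "f \<in> borel_measurable disc_measure"
      unfolding f_def using kernel_nonzero[OF z]
      by (intro measurable_disc_continuous continuous_intros) force+
    show "continuous_on {0..<1} (\<lambda>s. 1 / (1 - r * s) * (1 - s) powr - a)"
      using rs by (intro continuous_intros) force+
    fix w assume w: "w \<in> disc"
    have u: "norm (cnj z * w) < 1"
      using norm_mult_disc_less[of "cnj z" w] z w by (simp add: disc_def)
    have nu: "(norm (cnj z * w))\<^sup>2 = r * (norm w)\<^sup>2"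
      by (simp add: norm_mult r_def power_mult_distrib)
    have f_rot: "f (cis (2 * pi * t) * w)
        = 1 / (norm (1 - cnj z * w * cis (2 * pi * t)))\<^sup>2 * (1 - (norm w)\<^sup>2) powr - a" for t
      unfolding f_def norm_rotated_kernel by (simp add: norm_mult)
    show "((\<lambda>t. f (cis (2 * pi * t) * w)) has_integral 1 / (1 - r * (norm w)\<^sup>2) * (1 - (norm w)\<^sup>2) powr - a) {0..1}"
      unfolding f_rot using circle_mean_inverse_power2[OF u] unfolding nu by (rule has_integral_mult_left)
  qed (simp add: f_def)
  also have "\<dots> \<le> ennreal pi * ennreal ((1 / a + 1 / (1 - a)) * (1 - r) powr - a)"
    using a r by (intro mult_left_mono nn_integral_radial_kernel) auto
  finally show ?thesis
    by (simp add: f_def r_def ennreal_mult'[symmetric] mult_ac)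
qed

section \<open>Reproducing formulas for values and derivatives\<close>

lemma integrable_disc_mult_bounded:
  fixes f g :: "complex \<Rightarrow> complex"
  assumes f: "integrable disc_measure f" and g: "g \<in> borel_measurable disc_measure"
    and B: "\<And>w. w \<in> disc \<Longrightarrow> norm (g w) \<le> B"
  shows "integrable disc_measure (\<lambda>w. f w * g w)"
proof (rule Bochner_Integration.integrable_bound)
  show "integrable disc_measure (\<lambda>w. f w * of_real B)"
    using f by simp
  show "(\<lambda>w. f w * g w) \<in> borel_measurable disc_measure"
    using f g by measurable
  show "AE w in disc_measure. norm (f w * g w) \<le> norm (f w * of_real B)"
    using B by (intro AE_I2) (auto simp: norm_mult intro!: mult_left_mono order_trans[OF _ abs_ge_self])
qed

lemma norm_inverse_kernel_le:
  assumes "z \<in> disc" "w \<in> disc"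
  shows "1 / norm (1 - z * cnj w) ^ n \<le> 1 / (1 - norm z) ^ n"
  using assms norm_kernel_ge[of w z] by (intro divide_left_mono power_mono mult_pos_pos zero_less_power) (auto simp: disc_def)

text \<open>Circle means live on \<open>{0..<1}\<close>, since \<open>|w|^2 < 1\<close> in the disc,
  while the fundamental theorem is for the closed interval; the point 1 is a null set.\<close>

lemma LINT_lessThan_FTC:
  fixes F \<Psi> :: "real \<Rightarrow> complex"
  assumes "\<And>s. s \<in> {0..1} \<Longrightarrow> (F has_vector_derivative \<Psi> s) (at s within {0..1})"
    and "continuous_on {0..1} \<Psi>"
  shows "(LINT s:{0..<1}|lborel. \<Psi> s) = F 1 - F 0"
proof -
  have "(LINT s:{0..<1}|lborel. \<Psi> s) = (\<integral>s. indicator {0..1} s *\<^sub>R \<Psi> s \<partial>lborel)"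
    unfolding set_lebesgue_integral_def
    by (rule integral_discrete_difference[where X="{1}"]) (auto split: split_indicator)
  also have "\<dots> = F 1 - F 0"
    using assms by (intro integral_FTC_Icc) auto
  finally show ?thesis .
qed

lemma scale_disc:
  assumes "z \<in> disc" "s \<in> {0..1}"
  shows "z * of_real s \<in> disc"
  using assms mult_left_le[of s "norm z"] by (auto simp: disc_def norm_mult)

lemma has_vector_derivative_along_ray:
  fixes G :: "complex \<Rightarrow> complex"
  assumes "G holomorphic_on disc" "z \<in> disc" "s \<in> {0..1}"
  shows "((\<lambda>s. G (z * of_real s)) has_vector_derivative z * deriv G (z * of_real s)) (at s within T)"
proof -
  have "(G has_field_derivative deriv G (z * of_real s)) (at (z * of_real s))"
    using assms scale_disc by (intro holomorphic_derivI[where S=disc]) (auto simp: disc_def)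
  moreover have "((\<lambda>s. z * of_real s) has_vector_derivative z) (at s within T)"
    by (auto intro!: derivative_eq_intros)
  ultimately show ?thesis
    using field_vector_diff_chain_within[of "\<lambda>s. z * of_real s" z s T G "deriv G (z * of_real s)"]
    by (simp add: o_def has_field_derivative_at_within)
qed

lemma continuous_on_along_ray:
  assumes "G holomorphic_on disc" "z \<in> disc"
  shows "continuous_on {0..1} (\<lambda>s. G (z * complex_of_real s))"
  using assms scale_disc
  by (intro continuous_on_compose2[OF holomorphic_on_imp_continuous_on[OF assms(1)]] continuous_intros) auto

text \<open>\<open>k\<close> need not extend to the unit circle, but for \<open>|w| < 1\<close> its
  dilation by \<open>w\<close> does, so Cauchy's formula on the unit circle applies to the
  dilation.\<close>

lemma holomorphic_scaled:
  assumes k: "k holomorphic_on disc" and w: "w \<in> disc"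
  shows "continuous_on (cball 0 1) (\<lambda>v. k (v * w))" "(\<lambda>v. k (v * w)) holomorphic_on ball 0 1"
proof -
  have 1: "v * w \<in> disc" if "v \<in> cball 0 1" for v
    using w that mult_left_le_one_le[of "norm w" "norm v"] by (auto simp: disc_def norm_mult)
  show "continuous_on (cball 0 1) (\<lambda>v. k (v * w))"
    using 1 by (intro continuous_on_compose2[OF holomorphic_on_imp_continuous_on[OF k]] continuous_intros) auto
  show "(\<lambda>v. k (v * w)) holomorphic_on ball 0 1"
    using holomorphic_on_compose_gen[of "\<lambda>v. v * w" "ball 0 1" k disc] k 1
    by (force simp: o_def intro: holomorphic_on_mult)
qed

lemma DERIV_scaled:
  assumes k: "k holomorphic_on disc" and "c * w \<in> disc"
  shows "((\<lambda>v. k (v * w)) has_field_derivative w * deriv k (c * w)) (at c)"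
proof -
  have "(k has_field_derivative deriv k (c * w)) (at (c * w))"
    using assms by (intro holomorphic_derivI[where S=disc]) (auto simp: disc_def)
  moreover have "((\<lambda>v. v * w) has_field_derivative w) (at c)"
    by (auto intro!: derivative_eq_intros)
  ultimately show ?thesis
    using DERIV_chain2[of k "deriv k (c * w)" "\<lambda>v. v * w" c w UNIV] by (simp add: mult.commute)
qed

lemma cis_kernel:
  "1 - z * cnj (cis t * w) = (cis t - z * cnj w) / cis t"
  by (simp add: cis_cnj divide_inverse algebra_simps cis_mult)

text \<open>For \<open>v\<close> on the unit circle and \<open>c = z cnj w\<close>, the kernel at
  \<open>v w\<close> equals \<open>v^2 / (v - c)^2\<close>. Cauchy's formula yields the derivative
  of \<open>v k(v w)\<close> at \<open>c\<close>, and \<open>c w = z |w|^2\<close>. Hence the mean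
  over the circle through \<open>w\<close> is the derivative of \<open>s k(z s)\<close> at
  \<open>s = |w|^2\<close>, which integrates over \<open>[0, 1]\<close> to
  \<open>k z\<close>.\<close>

theorem bergman_reproducing:
  assumes k: "k holomorphic_on disc" "integrable disc_measure k" and z: "z \<in> disc"
  shows "(LINT w|disc_measure. k w / (1 - z * cnj w)\<^sup>2) = of_real pi * k z"
proof -
  define \<Psi> where "\<Psi> = (\<lambda>s::real. k (z * of_real s) + of_real s * (z * deriv k (z * of_real s)))"
  have dk: "deriv k holomorphic_on disc"
    using k by (intro holomorphic_deriv) (auto simp: disc_def)
  have \<Psi>: "continuous_on {0..1} \<Psi>"
    unfolding \<Psi>_def using k z dk by (intro continuous_intros continuous_on_along_ray)
  have cont: "continuous_on disc (\<lambda>w. 1 / (1 - z * cnj w)\<^sup>2)"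
    using kernel_nonzero[OF z] by (intro continuous_intros) auto
  have "integrable disc_measure (\<lambda>w. k w * (1 / (1 - z * cnj w)\<^sup>2))"
    using k cont norm_inverse_kernel_le[OF z, of _ 2]
    by (intro integrable_disc_mult_bounded measurable_disc_continuous) (auto simp: norm_divide norm_power)
  moreover have "continuous_on disc (\<lambda>w. k w * (1 / (1 - z * cnj w)\<^sup>2))"
    by (intro continuous_on_mult cont holomorphic_on_imp_continuous_on k)
  ultimately have "(LINT w|disc_measure. k w * (1 / (1 - z * cnj w)\<^sup>2))
      = of_real pi * (LINT s:{0..<1}|lborel. \<Psi> s)"
  proof (rule integral_disc_circle_mean)
    show "continuous_on {0..<1} \<Psi>"
      by (rule continuous_on_subset[OF \<Psi>]) auto
    fix w assume w: "w \<in> disc"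
    define c where "c = z * cnj w"
    have c: "norm c < 1"
      using norm_mult_disc_less[of z "cnj w"] z w by (simp add: c_def disc_def)
    have cw: "c * w = z * of_real ((norm w)\<^sup>2)"
      using complex_norm_square[of w] by (simp add: c_def mult_ac)
    have cwd: "c * w \<in> disc"
      using c w norm_mult_disc_less[of c w] by (simp add: disc_def)
    let ?g = "\<lambda>v. v * k (v * w)"
    have "((\<lambda>t. ?g (cis (2 * pi * t)) * cis (2 * pi * t) / (cis (2 * pi * t) - c) ^ Suc 1)
        has_integral (deriv ^^ 1) ?g c / fact 1) {0..1}"
      by (intro has_integral_circle_Cauchy c continuous_intros holomorphic_intros holomorphic_scaled k w)
    moreover have "deriv ?g c = \<Psi> ((norm w)\<^sup>2)"
    proof (rule DERIV_imp_deriv)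
      have "(?g has_field_derivative 1 * k (c * w) + w * deriv k (c * w) * c) (at c)"
        by (rule DERIV_mult[OF DERIV_ident DERIV_scaled[OF k(1) cwd]])
      also have "1 * k (c * w) + w * deriv k (c * w) * c = k (c * w) + (c * w) * deriv k (c * w)"
        by simp
      also have "\<dots> = \<Psi> ((norm w)\<^sup>2)"
        unfolding \<Psi>_def cw by simp
      finally show "(?g has_field_derivative \<Psi> ((norm w)\<^sup>2)) (at c)" .
    qed
    ultimately have "((\<lambda>t. ?g (cis (2 * pi * t)) * cis (2 * pi * t) / (cis (2 * pi * t) - c) ^ Suc 1)
        has_integral \<Psi> ((norm w)\<^sup>2)) {0..1}"
      by simp
    then show "((\<lambda>t. k (cis (2 * pi * t) * w) * (1 / (1 - z * cnj (cis (2 * pi * t) * w))\<^sup>2))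
        has_integral \<Psi> ((norm w)\<^sup>2)) {0..1}"
      by (rule has_integral_eq[rotated])
        (simp only: cis_kernel c_def[symmetric], simp add: power2_eq_square divide_simps)
  qed
  also have "(LINT s:{0..<1}|lborel. \<Psi> s) = of_real 1 * k (z * of_real 1) - of_real 0 * k (z * of_real 0)"
  proof (rule LINT_lessThan_FTC[OF _ \<Psi>])
    fix s :: real assume s: "s \<in> {0..1}"
    have "((\<lambda>s. of_real s * k (z * of_real s)) has_vector_derivative
        of_real s * (z * deriv k (z * of_real s)) + 1 * k (z * of_real s)) (at s within {0..1})"
      by (intro has_vector_derivative_mult has_vector_derivative_along_ray k z s)
        (auto intro!: derivative_eq_intros)
    then show "((\<lambda>s. of_real s * k (z * of_real s)) has_vector_derivative \<Psi> s) (at s within {0..1})"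
      by (simp add: \<Psi>_def add.commute)
  qed
  finally show ?thesis by simp
qed

text \<open>The previous computation is repeated, which avoids differentiation under the integral:
  the third-order pole gives half of a second derivative, and the circle mean is the derivative of
  \<open>(s^2 / 2) k'(z s)\<close>. The factor 1/2 matches
  \<open>d/dz (1 - z cnj w)^(-2) = 2 cnj w (1 - z cnj w)^(-3)\<close>.\<close>

theorem bergman_reproducing_deriv:
  assumes k: "k holomorphic_on disc" "integrable disc_measure k" and z: "z \<in> disc"
  shows "(LINT w|disc_measure. k w * (cnj w / (1 - z * cnj w) ^ 3)) = of_real pi * deriv k z / 2"
proof -
  define \<Psi> where "\<Psi> = (\<lambda>s::real. of_real s * deriv k (z * of_real s)
      + of_real (s\<^sup>2 / 2) * (z * deriv (deriv k) (z * of_real s)))"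
  have \<Psi>_eq: "\<Psi> s = of_real s * deriv k (z * of_real s)
      + of_real s * (z * of_real s) / 2 * deriv (deriv k) (z * of_real s)" for s
    by (simp add: \<Psi>_def power2_eq_square)
  have dk: "deriv k holomorphic_on disc"
    using k by (intro holomorphic_deriv) (auto simp: disc_def)
  then have ddk: "deriv (deriv k) holomorphic_on disc"
    by (rule holomorphic_deriv) (simp add: disc_def)
  have \<Psi>: "continuous_on {0..1} \<Psi>"
    unfolding \<Psi>_def using k z dk ddk by (intro continuous_intros continuous_on_along_ray) auto
  have cont: "continuous_on disc (\<lambda>w. cnj w / (1 - z * cnj w) ^ 3)"
    using kernel_nonzero[OF z] by (intro continuous_intros) auto
  have "norm (cnj w / (1 - z * cnj w) ^ 3) \<le> 1 * (1 / (1 - norm z) ^ 3)" if "w \<in> disc" for w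
  proof -
    have "norm (cnj w / (1 - z * cnj w) ^ 3) = norm w * (1 / norm (1 - z * cnj w) ^ 3)"
      by (simp add: norm_divide norm_power)
    also have "\<dots> \<le> 1 * (1 / (1 - norm z) ^ 3)"
      using that norm_inverse_kernel_le[OF z that, of 3] by (intro mult_mono) (auto simp: disc_def)
    finally show ?thesis .
  qed
  then have "integrable disc_measure (\<lambda>w. k w * (cnj w / (1 - z * cnj w) ^ 3))"
    using k cont by (intro integrable_disc_mult_bounded measurable_disc_continuous) auto
  moreover have "continuous_on disc (\<lambda>w. k w * (cnj w / (1 - z * cnj w) ^ 3))"
    by (intro continuous_on_mult cont holomorphic_on_imp_continuous_on k)
  ultimately have "(LINT w|disc_measure. k w * (cnj w / (1 - z * cnj w) ^ 3))
      = of_real pi * (LINT s:{0..<1}|lborel. \<Psi> s)"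
  proof (rule integral_disc_circle_mean)
    show "continuous_on {0..<1} \<Psi>"
      by (rule continuous_on_subset[OF \<Psi>]) auto
    fix w assume w: "w \<in> disc"
    define c where "c = z * cnj w"
    have c: "norm c < 1"
      using norm_mult_disc_less[of z "cnj w"] z w by (simp add: c_def disc_def)
    have ww: "of_real ((norm w)\<^sup>2) = w * cnj w"
      by (rule complex_norm_square)
    have cw: "c * w = z * of_real ((norm w)\<^sup>2)"
      unfolding ww c_def by (simp add: mult_ac)
    have vw: "v * w \<in> disc" if "v \<in> ball 0 1" for v
      using that w norm_mult_disc_less[of v w] by (simp add: disc_def)
    let ?g = "\<lambda>v. cnj w * (v * k (v * w))"
    let ?g' = "\<lambda>v. cnj w * (k (v * w) + w * deriv k (v * w) * v)"
    have "((\<lambda>t. ?g (cis (2 * pi * t)) * cis (2 * pi * t) / (cis (2 * pi * t) - c) ^ Suc 2)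
        has_integral (deriv ^^ 2) ?g c / fact 2) {0..1}"
      by (intro has_integral_circle_Cauchy c continuous_intros holomorphic_intros holomorphic_scaled k w)
    moreover have "deriv (deriv ?g) c = 2 * \<Psi> ((norm w)\<^sup>2)"
    proof -
      have "deriv ?g v = ?g' v" if v: "v \<in> ball 0 1" for v
      proof (rule DERIV_imp_deriv)
        have "(?g has_field_derivative cnj w * (1 * k (v * w) + w * deriv k (v * w) * v)) (at v)"
          by (rule DERIV_cmult[OF DERIV_mult[OF DERIV_ident DERIV_scaled[OF k(1) vw[OF v]]]])
        then show "(?g has_field_derivative ?g' v) (at v)" by simp
      qed
      \<comment> \<open>The second derivative at \<open>c\<close> needs the formula for the first
        one in a neighbourhood of \<open>c\<close>, not only at \<open>c\<close>.\<close>
      then have "\<forall>\<^sub>F v in nhds c. deriv ?g v = ?g' v"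
        using c by (intro eventually_nhds_in_open[THEN eventually_mono, where s1="ball 0 1"]) auto
      then have "deriv (deriv ?g) c = deriv ?g' c"
        by (rule deriv_cong_ev) simp
      also have "\<dots> = 2 * \<Psi> ((norm w)\<^sup>2)"
      proof (rule DERIV_imp_deriv)
        have cwd: "c * w \<in> disc" using c by (intro vw) simp
        have "(?g' has_field_derivative cnj w * (w * deriv k (c * w)
            + (w * (w * deriv (deriv k) (c * w)) * c + 1 * (w * deriv k (c * w))))) (at c)"
          by (intro DERIV_cmult DERIV_add DERIV_mult DERIV_ident DERIV_scaled k dk cwd)
        also have "cnj w * (w * deriv k (c * w)
            + (w * (w * deriv (deriv k) (c * w)) * c + 1 * (w * deriv k (c * w))))
            = 2 * ((w * cnj w) * deriv k (c * w) + (w * cnj w) * (c * w) / 2 * deriv (deriv k) (c * w))"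
          by (simp add: field_simps)
        also have "\<dots> = 2 * \<Psi> ((norm w)\<^sup>2)"
          unfolding \<Psi>_eq cw ww[symmetric] ..
        finally show "(?g' has_field_derivative 2 * \<Psi> ((norm w)\<^sup>2)) (at c)" .
      qed
      finally show ?thesis .
    qed
    ultimately have "((\<lambda>t. ?g (cis (2 * pi * t)) * cis (2 * pi * t) / (cis (2 * pi * t) - c) ^ Suc 2)
        has_integral \<Psi> ((norm w)\<^sup>2)) {0..1}"
      by (simp add: numeral_2_eq_2)
    then show "((\<lambda>t. k (cis (2 * pi * t) * w)
        * (cnj (cis (2 * pi * t) * w) / (1 - z * cnj (cis (2 * pi * t) * w)) ^ 3))
        has_integral \<Psi> ((norm w)\<^sup>2)) {0..1}"
    proof (rule has_integral_eq[rotated])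
      fix t
      let ?e = "cis (2 * pi * t)"
      have "cnj (?e * w) = cnj w / ?e"
        by (simp add: cis_cnj divide_inverse)
      then show "?g ?e * ?e / (?e - c) ^ Suc 2 = k (?e * w) * (cnj (?e * w) / (1 - z * cnj (?e * w)) ^ 3)"
        unfolding cis_kernel c_def[symmetric] by (simp add: power3_eq_cube)
    qed
  qed
  also have "(LINT s:{0..<1}|lborel. \<Psi> s)
      = of_real (1\<^sup>2 / 2) * deriv k (z * of_real 1) - of_real (0\<^sup>2 / 2) * deriv k (z * of_real 0)"
  proof (rule LINT_lessThan_FTC[OF _ \<Psi>])
    fix s :: real assume s: "s \<in> {0..1}"
    have "((\<lambda>s. of_real (s\<^sup>2 / 2)) has_vector_derivative of_real s) (at s within {0..1})"
      by (rule has_vector_derivative_of_real) (auto intro!: derivative_eq_intros)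
    then have "((\<lambda>s. of_real (s\<^sup>2 / 2) * deriv k (z * of_real s)) has_vector_derivative
        of_real (s\<^sup>2 / 2) * (z * deriv (deriv k) (z * of_real s)) + of_real s * deriv k (z * of_real s))
        (at s within {0..1})"
      by (intro has_vector_derivative_mult has_vector_derivative_along_ray dk z s)
    then show "((\<lambda>s. of_real (s\<^sup>2 / 2) * deriv k (z * of_real s)) has_vector_derivative \<Psi> s) (at s within {0..1})"
      by (simp add: \<Psi>_def add.commute)
  qed
  finally show ?thesis by simp
qed

section \<open>The first-order condition for the extremal function\<close>

lemma integrable_disc_bound:
  fixes f :: "complex \<Rightarrow> 'a :: {banach, second_countable_topology}" and g :: "complex \<Rightarrow> real"
  assumes "continuous_on disc f" "integrable disc_measure g" "\<And>w. w \<in> disc \<Longrightarrow> norm (f w) \<le> g w"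
  shows "integrable disc_measure f"
  using assms(2) measurable_disc_continuous[OF assms(1)]
proof (rule Bochner_Integration.integrable_bound)
  show "AE w in disc_measure. norm (f w) \<le> norm (g w)"
    using assms(3) by (intro AE_I2) (auto intro: order_trans[OF _ abs_ge_self])
qed

lemma integrable_disc_const: "integrable disc_measure (\<lambda>_. c :: 'a :: {banach, second_countable_topology})"
  using finite_measure.integrable_const[OF finite_measure_disc] .

lemma bergman_iff:
  "f \<in> bergman p \<longleftrightarrow> f holomorphic_on disc \<and> integrable disc_measure (\<lambda>z. norm (f z) powr p)"
  by (simp add: bergman_def set_integrable_def integrable_restrict_space)

lemma bergman_norm_eq:
  "bergman_norm p f = (1 / pi * (LINT z|disc_measure. norm (f z) powr p)) powr (1 / p)"
  by (simp add: bergman_norm_def set_lebesgue_integral_def integral_restrict_space)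

lemma kernel_functional_eq:
  "kernel_functional k f = of_real (1 / pi) * (LINT z|disc_measure. f z * cnj (k z))"
  by (simp add: kernel_functional_def sigma_integral_def set_lebesgue_integral_def integral_restrict_space)

lemma powr_add_le:
  fixes x y p :: real
  assumes "0 \<le> x" "0 \<le> y" "0 \<le> p"
  shows "(x + y) powr p \<le> 2 powr p * (x powr p + y powr p)"
proof -
  have "(x + y) powr p \<le> (2 * max x y) powr p"
    using assms by (intro powr_mono2) auto
  also have "\<dots> = 2 powr p * max x y powr p"
    using assms by (simp add: powr_mult)
  also have "\<dots> \<le> 2 powr p * (x powr p + y powr p)"
    by (intro mult_left_mono) (auto simp: max_def)
  finally show ?thesis .
qed

lemma powr_le_one_plus_powr:
  fixes x r p :: real
  assumes "0 \<le> x" "0 \<le> r" "r \<le> p"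
  shows "x powr r \<le> 1 + x powr p"
proof (cases "x \<le> 1")
  case True
  then have "x powr r \<le> 1"
    using assms powr_mono2[of r x 1] by simp
  then show ?thesis by (simp add: add_increasing2)
next
  case False
  then have "x powr r \<le> x powr p"
    using assms by (intro powr_mono) auto
  then show ?thesis by simp
qed

lemma continuous_on_norm_powr:
  assumes "continuous_on S f" "0 < p"
  shows "continuous_on S (\<lambda>x. norm (f x) powr p)"
  using assms by (intro continuous_on_powr' continuous_intros) auto

lemma bergman_integrable:
  assumes "1 < p" "f \<in> bergman p"
  shows "integrable disc_measure f"
proof (rule integrable_disc_bound)
  show "continuous_on disc f"
    using assms by (auto simp: bergman_iff intro: holomorphic_on_imp_continuous_on)
  show "integrable disc_measure (\<lambda>w. 1 + norm (f w) powr p)"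
    using assms integrable_disc_const[of "1 :: real"] by (auto simp: bergman_iff)
  show "norm (f w) \<le> 1 + norm (f w) powr p" for w
    using powr_le_one_plus_powr[of "norm (f w)" 1 p] assms by simp
qed

lemma bounded_in_bergman:
  assumes "h holomorphic_on disc" "\<And>w. w \<in> disc \<Longrightarrow> norm (h w) \<le> B" "0 < p"
  shows "h \<in> bergman p"
  unfolding bergman_iff
proof
  show "integrable disc_measure (\<lambda>w. norm (h w) powr p)"
  proof (rule integrable_disc_bound)
    show "continuous_on disc (\<lambda>w. norm (h w) powr p)"
      using assms by (intro continuous_on_norm_powr holomorphic_on_imp_continuous_on)
    show "integrable disc_measure (\<lambda>_. B powr p)"
      by (rule integrable_disc_const)
    show "norm (norm (h w) powr p) \<le> B powr p" if "w \<in> disc" for w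
      using assms(2)[OF that] assms(3) by (simp add: powr_mono2)
  qed
qed fact

lemma bergman_add:
  assumes "f \<in> bergman p" "g \<in> bergman p" "0 < p"
  shows "(\<lambda>w. f w + g w) \<in> bergman p"
  unfolding bergman_iff
proof
  show hol: "(\<lambda>w. f w + g w) holomorphic_on disc"
    using assms unfolding bergman_iff by (intro holomorphic_on_add) auto
  show "integrable disc_measure (\<lambda>w. norm (f w + g w) powr p)"
  proof (rule integrable_disc_bound)
    show "continuous_on disc (\<lambda>w. norm (f w + g w) powr p)"
      using assms hol by (intro continuous_on_norm_powr holomorphic_on_imp_continuous_on)
    show "integrable disc_measure (\<lambda>w. 2 powr p * (norm (f w) powr p + norm (g w) powr p))"
      using assms by (auto simp: bergman_iff)
    fix w
    have "norm (f w + g w) powr p \<le> (norm (f w) + norm (g w)) powr p"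
      using assms by (intro powr_mono2 norm_triangle_ineq) auto
    also have "\<dots> \<le> 2 powr p * (norm (f w) powr p + norm (g w) powr p)"
      using assms by (intro powr_add_le) auto
    finally show "norm (norm (f w + g w) powr p) \<le> 2 powr p * (norm (f w) powr p + norm (g w) powr p)"
      by simp
  qed
qed

lemma bergman_cmult:
  assumes "f \<in> bergman p"
  shows "(\<lambda>w. c * f w) \<in> bergman p"
  using assms unfolding bergman_iff
  by (auto simp: norm_mult powr_mult intro!: holomorphic_on_mult)

lemma bergman_mult_cnj_integrable:
  assumes "1 < p" "1 < q" "1 / p + 1 / q = 1" "f \<in> bergman p" "k \<in> bergman q"
  shows "integrable disc_measure (\<lambda>w. f w * cnj (k w))"
proof (rule integrable_disc_bound)
  show "continuous_on disc (\<lambda>w. f w * cnj (k w))"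
    using assms holomorphic_on_imp_continuous_on[of f disc] holomorphic_on_imp_continuous_on[of k disc]
    by (auto simp: bergman_iff intro!: continuous_intros)
  show "integrable disc_measure (\<lambda>w. norm (f w) powr p / p + norm (k w) powr q / q)"
    using assms by (auto simp: bergman_iff)
  show "norm (f w * cnj (k w)) \<le> norm (f w) powr p / p + norm (k w) powr q / q" for w
    using Youngs_inequality[OF assms(1-3), of "norm (f w)" "norm (k w)"] by (simp add: norm_mult)
qed

text \<open>Up to the factor \<open>p\<close>, the gradient of \<open>\<lambda>b. \<bar>b\<bar>\<^sup>p\<close>.\<close>

definition powr_gradient :: "real \<Rightarrow> complex \<Rightarrow> complex" where
  "powr_gradient p b = of_real (norm b powr (p - 2)) * b"

lemma norm_powr_gradient: "norm (powr_gradient p b) = norm b powr (p - 1)"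
proof (cases "b = 0")
  case False
  then have "norm b powr (p - 2) * norm b powr 1 = norm b powr (p - 2 + 1)"
    by (simp only: powr_add)
  then show ?thesis
    using False by (simp add: powr_gradient_def norm_mult)
qed (simp add: powr_gradient_def)

text \<open>For \<open>p < 2\<close> the factor \<open>norm b powr (p - 2)\<close> is singular at 0;
  continuity there comes from the modulus \<open>norm b powr (p - 1)\<close>, which tends to 0
  because \<open>p > 1\<close>.\<close>

lemma continuous_on_powr_gradient:
  assumes "1 < p"
  shows "continuous_on S (powr_gradient p)"
proof (rule continuous_at_imp_continuous_on, safe)
  fix b :: complex
  show "isCont (powr_gradient p) b"
  proof (cases "b = 0")
    case True
    have "continuous_on UNIV (\<lambda>b::complex. norm b powr (p - 1))"
      using assms by (intro continuous_on_norm_powr continuous_intros) auto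
    then have "isCont (\<lambda>b::complex. norm b powr (p - 1)) 0"
      by (simp add: continuous_on_eq_continuous_at)
    then have "(\<lambda>b::complex. norm (powr_gradient p b)) \<midarrow>0\<rightarrow> 0"
      by (simp add: isCont_def norm_powr_gradient)
    then have "powr_gradient p \<midarrow>0\<rightarrow> 0"
      by (rule tendsto_norm_zero_cancel)
    then show ?thesis
      using True by (simp add: isCont_def powr_gradient_def[of p 0])
  next
    case False
    then show ?thesis
      unfolding powr_gradient_def[abs_def] by (intro continuous_intros) auto
  qed
qed

text \<open>The graph of the convex function \<open>|a|^p\<close> lies above its tangent plane at
  \<open>b\<close>. After \<open>Re (cnj b * a) \<le> norm b * norm a\<close> this is Young's
  inequality for \<open>norm a\<close> and \<open>norm b powr (p - 1)\<close> with exponents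
  \<open>p\<close> and \<open>p / (p - 1)\<close>, so the power of the modulus is never
  differentiated.\<close>

lemma powr_convexity:
  fixes a b :: complex
  assumes p: "1 < p"
  shows "norm b powr p + p * Re (cnj (powr_gradient p b) * (a - b)) \<le> norm a powr p"
proof (cases "b = 0")
  case False
  define x where "x = norm b"
  have x: "x > 0" using False by (simp add: x_def)
  have e: "x powr (p - 2) * x = x powr (p - 1)" "x powr (p - 2) * x\<^sup>2 = x powr p"
    using x by (simp_all add: powr_diff power2_eq_square)
  have "cnj b * (a - b) = cnj b * a - of_real (x\<^sup>2)"
    unfolding x_def complex_norm_square by (simp add: algebra_simps)
  then have "Re (cnj b * (a - b)) = Re (cnj b * a) - x\<^sup>2"
    by (simp only: minus_complex.sel Re_complex_of_real)
  also have "Re (cnj b * a) \<le> x * norm a"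
    using complex_Re_le_cmod[of "cnj b * a"] by (simp add: norm_mult x_def)
  finally have "x powr (p - 2) * Re (cnj b * (a - b)) \<le> x powr (p - 2) * (x * norm a - x\<^sup>2)"
    by (simp add: mult_left_mono)
  also have "\<dots> = norm a * x powr (p - 1) - x powr p"
    using e by (simp add: right_diff_distrib mult_ac)
  also have "norm a * x powr (p - 1) \<le> norm a powr p / p + (x powr (p - 1)) powr (p / (p - 1)) / (p / (p - 1))"
    using p by (intro Youngs_inequality) (auto simp: field_simps)
  also have "(x powr (p - 1)) powr (p / (p - 1)) = x powr p"
    using p by (simp add: powr_powr)
  finally have *: "x powr (p - 2) * Re (cnj b * (a - b)) \<le> (norm a powr p - x powr p) / p"
    using p by (simp add: field_simps)
  have "cnj (powr_gradient p b) * (a - b) = of_real (x powr (p - 2)) * (cnj b * (a - b))"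
    by (simp add: powr_gradient_def x_def mult.assoc)
  moreover have "Re (of_real c * v) = c * Re v" for c v by simp
  ultimately have "Re (cnj (powr_gradient p b) * (a - b)) = x powr (p - 2) * Re (cnj b * (a - b))"
    by (simp only:)
  with * have "Re (cnj (powr_gradient p b) * (a - b)) \<le> (norm a powr p - x powr p) / p"
    by (simp only:)
  then have "p * Re (cnj (powr_gradient p b) * (a - b)) \<le> norm a powr p - x powr p"
    using p by (metis mult.commute pos_le_divide_eq less_trans zero_less_one)
  then show ?thesis
    unfolding x_def by linarith
qed (use p in \<open>simp add: powr_gradient_def\<close>)

section \<open>Inequalities satisfied by the extremal function\<close>

lemma kernel_functional_cmult: "kernel_functional k (\<lambda>w. c * f w) = c * kernel_functional k f"
  by (simp add: kernel_functional_eq mult.assoc mult.left_commute)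

text \<open>Normalising \<open>g\<close> reduces the claim to the unit sphere. A function of norm 0
  cannot be normalised, but it vanishes almost everywhere and its pairing with \<open>k\<close> is
  0.\<close>

lemma extremal_bound:
  assumes p: "1 < p" and ext: "extremal p k F" and g: "g \<in> bergman p"
  shows "Re (kernel_functional k g) \<le> Re (kernel_functional k F) * bergman_norm p g"
proof (cases "bergman_norm p g = 0")
  case True
  then have "(LINT z|disc_measure. norm (g z) powr p) = 0"
    by (simp add: bergman_norm_eq)
  then have "AE z in disc_measure. norm (g z) powr p = 0"
    using g by (subst (asm) integral_nonneg_eq_0_iff_AE) (auto simp: bergman_iff)
  then have "AE z in disc_measure. g z * cnj (k z) = 0"
    by eventually_elim simp
  then have "(LINT z|disc_measure. g z * cnj (k z)) = 0"
    by (rule integral_eq_zero_AE)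
  then show ?thesis
    using True by (simp add: kernel_functional_eq)
next
  case False
  define N where "N = bergman_norm p g"
  have N: "N > 0" "(LINT z|disc_measure. norm (g z) powr p) = pi * N powr p"
    using False p by (auto simp: N_def bergman_norm_eq powr_powr)
  have "bergman_norm p (\<lambda>w. of_real (1 / N) * g w)
      = (1 / pi * ((1 / N) powr p * (LINT z|disc_measure. norm (g z) powr p))) powr (1 / p)"
    using N by (simp add: bergman_norm_eq norm_divide powr_divide)
  also have "1 / pi * ((1 / N) powr p * (LINT z|disc_measure. norm (g z) powr p)) = (1 / N) powr p * N powr p"
    unfolding N(2) by simp
  also have "\<dots> = 1"
    using N by (simp add: powr_divide)
  finally have "bergman_norm p (\<lambda>w. of_real (1 / N) * g w) = 1" by simp
  then have "Re (kernel_functional k (\<lambda>w. of_real (1 / N) * g w)) \<le> Re (kernel_functional k F)"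
    using ext bergman_cmult[OF g, of "of_real (1 / N)"] unfolding extremal_def by blast
  then have "Re (kernel_functional k g) / N \<le> Re (kernel_functional k F)"
    unfolding kernel_functional_cmult by simp
  then show ?thesis
    using N by (simp add: N_def[symmetric] field_simps)
qed

text \<open>The competitor \<open>- F\<close> has norm 1 and the opposite value. The sign matters
  because upper bounds for norms are later multiplied by this number.\<close>

lemma extremal_value_nonneg:
  assumes "extremal p k F"
  shows "0 \<le> Re (kernel_functional k F)"
proof -
  have "F \<in> bergman p" "bergman_norm p F = 1"
    using assms by (auto simp: extremal_def)
  then have "bergman_norm p (\<lambda>w. (- 1) * F w) = 1"
    by (simp add: bergman_norm_eq)
  then have "Re (kernel_functional k (\<lambda>w. (- 1) * F w)) \<le> Re (kernel_functional k F)"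
    using assms bergman_cmult[OF \<open>F \<in> bergman p\<close>, of "- 1"] unfolding extremal_def by blast
  then show ?thesis
    unfolding kernel_functional_cmult by simp
qed

text \<open>The concave function \<open>I powr (1 / p)\<close> lies below its tangent at
  \<open>I = 1\<close>, the value attained by the extremal function. A norm near 1 is thus
  controlled by its \<open>p\<close>-th power, which is an integral.\<close>

lemma powr_inverse_le_linear:
  fixes p I :: real
  assumes "1 < p" "0 \<le> I"
  shows "I powr (1 / p) \<le> 1 + (I - 1) / p"
proof -
  have "I powr (1 / p) * 1 \<le> (I powr (1 / p)) powr p / p + 1 powr (p / (p - 1)) / (p / (p - 1))"
    using assms by (intro Youngs_inequality) (auto simp: diff_divide_distrib)
  also have "\<dots> = I / p + (p - 1) / p"
    using assms by (simp add: powr_powr)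
  also have "\<dots> = 1 + (I - 1) / p"
    using assms by (simp add: diff_divide_distrib)
  finally show ?thesis by simp
qed

lemma powr_gradient_integrable:
  assumes p: "1 < p" and F: "F \<in> bergman p"
  shows "integrable disc_measure (\<lambda>w. powr_gradient p (F w))"
proof (rule integrable_disc_bound)
  show "continuous_on disc (\<lambda>w. powr_gradient p (F w))"
    using F by (intro continuous_on_compose2[OF continuous_on_powr_gradient[OF p, of UNIV]])
      (auto simp: bergman_iff intro: holomorphic_on_imp_continuous_on)
  show "integrable disc_measure (\<lambda>w. 1 + norm (F w) powr p)"
    using F integrable_disc_const[of "1 :: real"] by (auto simp: bergman_iff)
  show "norm (powr_gradient p (F w)) \<le> 1 + norm (F w) powr p" for w
    using p by (simp add: norm_powr_gradient powr_le_one_plus_powr)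
qed

text \<open>The first-order condition at the maximum: \<open>t \<mapsto> M \<parallel>F + t h\<parallel> - Re \<phi> (F + t h)\<close> is nonnegative
  and vanishes at \<open>t = 0\<close>. Convexity bounds the difference quotient of the norm by an integral
  that is continuous in \<open>t\<close>, so only the integrand has to be passed to the limit.\<close>

lemma extremal_variation_le:
  assumes p: "1 < p" and q: "q = p / (p - 1)" and k: "k \<in> bergman q" and ext: "extremal p k F"
    and h: "h holomorphic_on disc" and B: "\<And>w. w \<in> disc \<Longrightarrow> norm (h w) \<le> B"
  shows "Re (kernel_functional k h)
    \<le> Re (kernel_functional k F) * (1 / pi * (LINT w|disc_measure. Re (cnj (powr_gradient p (F w)) * h w)))"
proof -
  define M where "M = Re (kernel_functional k F)"
  have M: "M \<ge> 0" using extremal_value_nonneg[OF ext] by (simp add: M_def)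
  have pq: "1 < q" "1 / p + 1 / q = 1"
    using p by (auto simp: q field_simps)
  have F: "F \<in> bergman p" "bergman_norm p F = 1"
    using ext by (auto simp: extremal_def)
  have hb: "h \<in> bergman p"
    using bounded_in_bergman[OF h B] p by simp
  have F_int: "1 / pi * (LINT w|disc_measure. norm (F w) powr p) = 1"
  proof -
    have "0 \<le> 1 / pi * (LINT w|disc_measure. norm (F w) powr p)" by simp
    then have "(1 / pi * (LINT w|disc_measure. norm (F w) powr p)) = (bergman_norm p F) powr p"
      using p by (simp add: bergman_norm_eq powr_powr)
    then show ?thesis using F by simp
  qed
  have B0: "B \<ge> 0"
    using order_trans[OF norm_ge_zero B[of 0]] by (simp add: disc_def)
  have cont: "continuous_on disc F" "continuous_on disc h"
    using F h by (auto simp: bergman_iff intro: holomorphic_on_imp_continuous_on)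
  \<comment> \<open>Up to the factor \<open>p\<close>, \<open>s t w\<close> is the derivative in
    \<open>t\<close> of \<open>|F w + t h w|^p\<close>; \<open>D\<close> dominates it on the disc
    for all \<open>t\<close> in \<open>[0, 1]\<close>.\<close>
  define s where "s = (\<lambda>t w. Re (cnj (powr_gradient p (F w + of_real t * h w)) * h w))"
  define D where "D = (\<lambda>w. B * (1 + 2 powr p * (norm (F w) powr p + B powr p)))"
  have s_cont: "continuous_on disc (s t)" for t
    unfolding s_def using cont
    by (intro continuous_intros continuous_on_compose2[OF continuous_on_powr_gradient[OF p, of UNIV]]) auto
  have D_int: "integrable disc_measure D"
    unfolding D_def using F integrable_disc_const[of "1 :: real"] integrable_disc_const[of "B powr p"]
    by (auto simp: bergman_iff)
  have s_bound: "norm (s t w) \<le> D w" if w: "w \<in> disc" and t: "t \<in> {0..1}" for t w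
  proof -
    have "norm (F w + of_real t * h w) \<le> norm (F w) + t * norm (h w)"
      using t norm_triangle_ineq[of "F w" "of_real t * h w"] by (simp add: norm_mult)
    also have "t * norm (h w) \<le> 1 * B"
      using t B[OF w] by (intro mult_mono) auto
    finally have 1: "norm (F w + of_real t * h w) \<le> norm (F w) + B" by simp
    have "norm (s t w) \<le> norm (cnj (powr_gradient p (F w + of_real t * h w)) * h w)"
      unfolding s_def real_norm_def by (rule abs_Re_le_cmod)
    also have "\<dots> = norm (h w) * norm (F w + of_real t * h w) powr (p - 1)"
      by (simp add: norm_mult norm_powr_gradient)
    also have "\<dots> \<le> B * (1 + norm (F w + of_real t * h w) powr p)"
      using B[OF w] p B0 by (intro mult_mono powr_le_one_plus_powr) auto
    also have "norm (F w + of_real t * h w) powr p \<le> (norm (F w) + B) powr p"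
      using 1 p by (intro powr_mono2) auto
    also have "\<dots> \<le> 2 powr p * (norm (F w) powr p + B powr p)"
      using p B0 by (intro powr_add_le) auto
    finally show ?thesis using B0 by (simp add: D_def mult_left_mono)
  qed
  have s_int: "integrable disc_measure (s t)" if "t \<in> {0..1}" for t
    by (rule integrable_disc_bound[OF s_cont D_int s_bound]) (use that in auto)
  have step: "Re (kernel_functional k h) \<le> M * (1 / pi * (LINT w|disc_measure. s t w))"
    if t: "0 < t" "t \<le> 1" for t
  proof -
    define g where "g = (\<lambda>w. F w + of_real t * h w)"
    have g: "g \<in> bergman p"
      unfolding g_def using p by (intro bergman_add F bergman_cmult hb) auto
    have int_k: "integrable disc_measure (\<lambda>w. f w * cnj (k w))" if "f \<in> bergman p" for f
      using bergman_mult_cnj_integrable[OF p pq that k] .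
    define I where "I = 1 / pi * (LINT w|disc_measure. norm (g w) powr p)"
    have I0: "I \<ge> 0" by (simp add: I_def)
    have "M + t * Re (kernel_functional k h) = Re (kernel_functional k g)"
    proof -
      have "(LINT w|disc_measure. g w * cnj (k w))
          = (LINT w|disc_measure. F w * cnj (k w) + of_real t * (h w * cnj (k w)))"
        by (simp add: g_def algebra_simps)
      also have "\<dots> = (LINT w|disc_measure. F w * cnj (k w)) + of_real t * (LINT w|disc_measure. h w * cnj (k w))"
        using int_k[OF F(1)] int_k[OF hb] by simp
      finally have "kernel_functional k g = kernel_functional k F + of_real t * kernel_functional k h"
        by (simp add: kernel_functional_eq algebra_simps)
      then show ?thesis by (simp add: M_def)
    qed
    also have "\<dots> \<le> M * I powr (1 / p)"
      using extremal_bound[OF p ext g] by (simp add: M_def bergman_norm_eq I_def)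
    also have "\<dots> \<le> M * (1 + (I - 1) / p)"
      using M I0 p by (intro mult_left_mono powr_inverse_le_linear)
    also have "\<dots> \<le> M * (1 + t * (1 / pi * (LINT w|disc_measure. s t w)))"
    proof -
      \<comment> \<open>The tangent inequality is taken at the perturbed point \<open>g w\<close>
        and evaluated at \<open>F w\<close>, because an upper bound for the norm of \<open>g\<close>
        is required. This puts the gradient at \<open>F + t h\<close>, which is why a limit in
        \<open>t\<close> remains.\<close>
      have "norm (g w) powr p - p * t * s t w \<le> norm (F w) powr p" for w
      proof -
        have "Re (cnj (powr_gradient p (g w)) * (F w - g w)) = - t * s t w"
        proof -
          have "cnj (powr_gradient p (g w)) * (F w - g w) = of_real (- t) * (cnj (powr_gradient p (g w)) * h w)"
            by (simp add: g_def)
          also have "Re \<dots> = - t * s t w"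
            by (simp only: s_def g_def Re_complex_of_real Im_complex_of_real times_complex.sel)
          finally show ?thesis .
        qed
        then show ?thesis
          using powr_convexity[OF p, of "g w" "F w"] by simp
      qed
      then have "(LINT w|disc_measure. norm (g w) powr p - p * t * s t w) \<le> (LINT w|disc_measure. norm (F w) powr p)"
        using g F s_int[of t] t by (intro integral_mono) (auto simp: bergman_iff)
      then have "(LINT w|disc_measure. norm (g w) powr p) - p * t * (LINT w|disc_measure. s t w)
          \<le> (LINT w|disc_measure. norm (F w) powr p)"
        using g s_int[of t] t by (simp add: bergman_iff)
      also have "\<dots> = pi"
        using F_int by (simp add: field_simps)
      finally have "(LINT w|disc_measure. norm (g w) powr p) / pi \<le> (pi + p * t * (LINT w|disc_measure. s t w)) / pi"
        by (intro divide_right_mono) auto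
      then have "I - 1 \<le> p * (t * (1 / pi * (LINT w|disc_measure. s t w)))"
        by (simp add: I_def add_divide_distrib)
      then have "(I - 1) / p \<le> t * (1 / pi * (LINT w|disc_measure. s t w))"
        using p by (simp add: pos_divide_le_eq mult.commute)
      then show ?thesis
        using M by (intro mult_left_mono add_left_mono)
    qed
    finally have "t * Re (kernel_functional k h) \<le> t * (M * (1 / pi * (LINT w|disc_measure. s t w)))"
      by (simp add: algebra_simps)
    then show ?thesis
      by (rule mult_left_le_imp_le[OF _ t(1)])
  qed
  have "(\<lambda>n. LINT w|disc_measure. s (1 / real (Suc n)) w) \<longlonglongrightarrow> (LINT w|disc_measure. s 0 w)"
  proof (rule integral_dominated_convergence[where w=D])
    show "AE w in disc_measure. (\<lambda>n. s (1 / real (Suc n)) w) \<longlonglongrightarrow> s 0 w"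
    proof (rule AE_I2)
      fix w
      have "continuous_on UNIV (\<lambda>t. s t w)"
        unfolding s_def
        by (intro continuous_intros continuous_on_compose2[OF continuous_on_powr_gradient[OF p, of UNIV]]) auto
      then have "isCont (\<lambda>t. s t w) 0"
        by (simp add: continuous_on_eq_continuous_at)
      from isCont_tendsto_compose[OF this LIMSEQ_inverse_real_of_nat]
      show "(\<lambda>n. s (1 / real (Suc n)) w) \<longlonglongrightarrow> s 0 w"
        by (simp only: inverse_eq_divide)
    qed
    show "AE w in disc_measure. norm (s (1 / real (Suc n)) w) \<le> D w" for n
      by (intro AE_I2 s_bound) auto
  qed (fact measurable_disc_continuous[OF s_cont] D_int)+
  then have lim: "(\<lambda>n. M * (1 / pi * (LINT w|disc_measure. s (1 / real (Suc n)) w)))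
      \<longlonglongrightarrow> M * (1 / pi * (LINT w|disc_measure. s 0 w))"
    by (rule tendsto_mult_left[OF tendsto_mult_left])
  have "Re (kernel_functional k h) \<le> M * (1 / pi * (LINT w|disc_measure. s (1 / real (Suc n)) w))" for n
    by (rule step) auto
  then have "Re (kernel_functional k h) \<le> M * (1 / pi * (LINT w|disc_measure. s 0 w))"
    by (intro LIMSEQ_le_const[OF lim]) blast
  then show ?thesis by (simp add: s_def M_def)
qed

text \<open>The inequality for one \<open>h\<close> holds for every complex multiple
  \<open>c * h\<close>, so \<open>Re (c * L) \<le> 0\<close> for the difference \<open>L\<close> of
  the two pairings and all \<open>c\<close>; the choice \<open>c = cnj L\<close> forces
  \<open>L = 0\<close>. Conjugation at the end puts the analytic test function under
  \<open>cnj\<close>, as in the reproducing formulas.\<close>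

lemma extremal_variation:
  assumes p: "1 < p" and q: "q = p / (p - 1)" and k: "k \<in> bergman q" and ext: "extremal p k F"
    and h: "h holomorphic_on disc" and B: "\<And>w. w \<in> disc \<Longrightarrow> norm (h w) \<le> B"
  shows "(LINT w|disc_measure. k w * cnj (h w))
    = of_real (Re (kernel_functional k F)) * (LINT w|disc_measure. powr_gradient p (F w) * cnj (h w))"
proof -
  define M where "M = Re (kernel_functional k F)"
  define L where "L = (LINT w|disc_measure. h w * cnj (k w))
      - of_real M * (LINT w|disc_measure. cnj (powr_gradient p (F w)) * h w)"
  have F: "F \<in> bergman p"
    using ext by (auto simp: extremal_def)
  have int: "integrable disc_measure (\<lambda>w. cnj (powr_gradient p (F w)) * h w)"
    using powr_gradient_integrable[OF p F] B h
    by (intro integrable_disc_mult_bounded measurable_disc_continuous holomorphic_on_imp_continuous_on) auto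
  have "Re (c * L) \<le> 0" for c
  proof -
    have "norm (c * h w) \<le> norm c * B" if "w \<in> disc" for w
      using B[OF that] by (simp add: norm_mult mult_left_mono)
    from extremal_variation_le[OF p q k ext _ this]
    have "Re (kernel_functional k (\<lambda>w. c * h w))
        \<le> M * (1 / pi * (LINT w|disc_measure. Re (c * (cnj (powr_gradient p (F w)) * h w))))"
      using h by (simp add: M_def holomorphic_on_mult mult_ac)
    also have "(LINT w|disc_measure. Re (c * (cnj (powr_gradient p (F w)) * h w)))
        = Re (c * (LINT w|disc_measure. cnj (powr_gradient p (F w)) * h w))"
      using int by (subst integral_Re) auto
    finally have "pi * Re (kernel_functional k (\<lambda>w. c * h w))
        \<le> Re (of_real M * (c * (LINT w|disc_measure. cnj (powr_gradient p (F w)) * h w)))"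
      by (simp add: field_simps)
    moreover have "pi * Re (kernel_functional k (\<lambda>w. c * h w)) = Re (c * (LINT w|disc_measure. h w * cnj (k w)))"
      unfolding kernel_functional_cmult by (simp add: kernel_functional_eq mult.left_commute)
    ultimately show ?thesis
      by (simp add: L_def algebra_simps)
  qed
  from this[of "cnj L"] have "(norm L)\<^sup>2 \<le> 0"
    using complex_norm_square[of L] by (simp add: mult.commute cmod_power2 flip: power2_eq_square)
  then have "cnj L = 0" by simp
  moreover have "cnj L = (LINT w|disc_measure. k w * cnj (h w))
      - of_real M * (LINT w|disc_measure. powr_gradient p (F w) * cnj (h w))"
    unfolding L_def complex_cnj_diff complex_cnj_mult complex_cnj_complex_of_real
      Bochner_Integration.integral_cnj[symmetric] complex_cnj_cnj by (simp only: mult.commute)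
  ultimately show ?thesis by (simp add: M_def)
qed

section \<open>Regularity of the kernel\<close>

lemma integral_le_of_nn_integral_le:
  fixes f :: "'a \<Rightarrow> real"
  assumes f: "f \<in> borel_measurable M" "\<And>x. x \<in> space M \<Longrightarrow> 0 \<le> f x"
    and le: "(\<integral>\<^sup>+x. ennreal (f x) \<partial>M) \<le> ennreal c" and c: "0 \<le> c"
  shows "integrable M f" "integral\<^sup>L M f \<le> c"
proof -
  show int: "integrable M f"
  proof (rule integrableI_nonneg)
    show "(\<integral>\<^sup>+x. ennreal (f x) \<partial>M) < \<infinity>"
      by (rule order_le_less_trans[OF le]) simp
  qed (use f in \<open>auto intro: AE_I2\<close>)
  have "ennreal (integral\<^sup>L M f) \<le> ennreal c"
    using le f by (subst nn_integral_eq_integral[symmetric, OF int]) (auto intro: AE_I2)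
  then show "integral\<^sup>L M f \<le> c"
    using c by (simp add: ennreal_le_iff)
qed

lemma one_minus_norm_square_pos: "w \<in> disc \<Longrightarrow> 0 < 1 - (norm w)\<^sup>2"
  by (simp add: disc_def abs_square_less_1)

lemma continuous_on_kernel:
  "z \<in> disc \<Longrightarrow> continuous_on disc (\<lambda>w. 1 / norm (1 - z * cnj w) ^ n)"
  using kernel_nonzero by (intro continuous_intros) auto

lemma continuous_on_weight: "continuous_on disc (\<lambda>w. (1 - (norm w)\<^sup>2) powr a)"
  using one_minus_norm_square_pos by (intro continuous_intros) force

text \<open>Young's inequality is integrated with a free scale \<open>l\<close>, which is chosen
  only afterwards. With \<open>l powr (q / (q - 1)) = T / N\<close> the first term becomes the
  fraction \<open>1 - 1 / q\<close> of \<open>T\<close> and is absorbed on the left.\<close>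

lemma Hoelder_from_Young:
  fixes T N G q :: real
  assumes q: "1 < q" and "0 \<le> T" "0 < N" "0 \<le> G"
    and le: "\<And>l. 0 < l \<Longrightarrow> T \<le> l powr (q / (q - 1)) / (q / (q - 1)) * N + l powr (- q) / q * G"
  shows "T powr q \<le> N powr (q - 1) * G"
proof (cases "T = 0")
  case False
  define l where "l = (T / N) powr ((q - 1) / q)"
  have T: "T > 0" using False assms by simp
  have l: "l > 0" using T assms by (simp add: l_def)
  have l1: "l powr (q / (q - 1)) = T / N"
    using q T assms by (simp add: l_def powr_powr)
  have l2: "l powr (- q) = (T / N) powr - (q - 1)"
    using q by (simp add: l_def powr_powr)
  have "(T / N) powr - (q - 1) = N powr (q - 1) / T powr (q - 1)"
    using T assms by (subst powr_minus) (simp add: powr_divide)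
  note l2 = l2[unfolded this]
  have "T \<le> T / (q / (q - 1)) + l powr (- q) / q * G"
    using le[OF l] assms unfolding l1 by simp
  moreover have "T - T / (q / (q - 1)) = T / q"
    using q by (simp add: field_simps)
  ultimately have "T \<le> l powr (- q) * G"
    using q by (simp add: field_simps)
  also have "l powr (- q) = N powr (q - 1) / T powr (q - 1)"
    by (rule l2)
  finally have "T * T powr (q - 1) \<le> N powr (q - 1) * G"
    using T by (simp add: field_simps)
  moreover have "T * T powr (q - 1) = T powr q"
    using T by (simp add: powr_diff)
  ultimately show ?thesis by simp
qed (use assms in simp)

text \<open>Schur's test for \<open>\<bar>1 - z cnj w\<bar>\<^bsup>-2\<^esup>\<close> with the weight \<open>(1 - \<bar>w\<bar>\<^sup>2)\<^bsup>-e\<^esup>\<close>, \<open>e = (1 - 1/q) / q\<close>.\<close>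

lemma bergman_kernel_pointwise:
  assumes q: "1 < q" and g: "continuous_on disc g" "\<And>w. w \<in> disc \<Longrightarrow> 0 \<le> g w"
    and g_int: "integrable disc_measure g" and gq_int: "integrable disc_measure (\<lambda>w. g w powr q)"
    and z: "z \<in> disc"
  defines "C \<equiv> pi * (1 / (1 / q) + 1 / (1 - 1 / q))"
  shows "ennreal ((LINT w|disc_measure. g w * (1 / norm (1 - z * cnj w) ^ 2)) powr q)
    \<le> (\<integral>\<^sup>+w. ennreal (C powr (q - 1) * ((1 - (norm z)\<^sup>2) powr - (1 - 1 / q)
        * (1 / norm (1 - z * cnj w) ^ 2) * ((1 - (norm w)\<^sup>2) powr (1 - 1 / q) * g w powr q))) \<partial>disc_measure)"
proof -
  define K where "K = (\<lambda>w. 1 / norm (1 - z * cnj w) ^ 2)"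
  define m where "m = (\<lambda>w::complex. 1 - (norm w)\<^sup>2)"
  define T where "T = (LINT w|disc_measure. g w * K w)"
  \<comment> \<open>\<open>N\<close> bounds the integral of \<open>K\<close> against the weight
    \<open>m powr - (1 / q)\<close>, by the squared-kernel estimate with \<open>a = 1 / q\<close>;
    \<open>G\<close> is the other Hoelder factor.\<close>
  define N where "N = C * m z powr - (1 / q)"
  define G where "G = (LINT w|disc_measure. K w * (m w powr (1 - 1 / q) * g w powr q))"
  define q' where "q' = q / (q - 1)"
  have m: "0 < m w" if "w \<in> disc" for w
    using one_minus_norm_square_pos[OF that] by (simp add: m_def)
  have C: "C > 0" using q by (auto simp: C_def intro!: mult_pos_pos add_pos_pos)
  have N: "N > 0" using C m[OF z] by (simp add: N_def)
  have K_cont: "continuous_on disc K"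
    unfolding K_def by (rule continuous_on_kernel[OF z])
  have K_nonneg: "0 \<le> K w" for w by (simp add: K_def)
  have K_le: "K w \<le> 1 / (1 - norm z) ^ 2" if "w \<in> disc" for w
    unfolding K_def by (rule norm_inverse_kernel_le[OF z that])
  have gq_cont: "continuous_on disc (\<lambda>w. g w powr q)"
    using g q by (intro continuous_on_powr' continuous_intros) auto
  have T_int: "integrable disc_measure (\<lambda>w. g w * K w)"
  proof (rule integrable_disc_bound)
    show "continuous_on disc (\<lambda>w. g w * K w)" by (intro continuous_on_mult g K_cont)
    show "integrable disc_measure (\<lambda>w. g w * (1 / (1 - norm z) ^ 2))" using g_int by simp
    show "norm (g w * K w) \<le> g w * (1 / (1 - norm z) ^ 2)" if "w \<in> disc" for w
      using mult_left_mono[OF K_le[OF that] g(2)[OF that]] g(2)[OF that] K_nonneg[of w] by simp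
  qed
  have G_cont: "continuous_on disc (\<lambda>w. K w * (m w powr (1 - 1 / q) * g w powr q))"
    unfolding m_def by (intro continuous_on_mult K_cont gq_cont continuous_on_weight)
  have G_int: "integrable disc_measure (\<lambda>w. K w * (m w powr (1 - 1 / q) * g w powr q))"
  proof (rule integrable_disc_bound[OF G_cont])
    show "integrable disc_measure (\<lambda>w. 1 / (1 - norm z) ^ 2 * (1 * g w powr q))" using gq_int by simp
    fix w assume w: "w \<in> disc"
    have "m w powr (1 - 1 / q) \<le> 1 powr (1 - 1 / q)"
      using m[OF w] q by (intro powr_mono2) (auto simp: m_def)
    then have "K w * (m w powr (1 - 1 / q) * g w powr q) \<le> 1 / (1 - norm z) ^ 2 * (1 * g w powr q)"
      using K_le[OF w] K_nonneg by (intro mult_mono) auto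
    then show "norm (K w * (m w powr (1 - 1 / q) * g w powr q)) \<le> 1 / (1 - norm z) ^ 2 * (1 * g w powr q)"
      using K_nonneg[of w] by simp
  qed
  have A_cont: "continuous_on disc (\<lambda>w. K w * m w powr - (1 / q))"
    unfolding m_def by (intro continuous_on_mult K_cont continuous_on_weight)
  have "(\<integral>\<^sup>+w. ennreal (K w * m w powr - (1 / q)) \<partial>disc_measure) \<le> ennreal N"
    unfolding K_def m_def N_def C_def using q by (intro nn_integral_kernel_power2 z) auto
  note A = integral_le_of_nn_integral_le[OF measurable_disc_continuous[OF A_cont] _ this less_imp_le[OF N]]
  have A_int: "integrable disc_measure (\<lambda>w. K w * m w powr - (1 / q))"
    and A_le: "(LINT w|disc_measure. K w * m w powr - (1 / q)) \<le> N"
    using K_nonneg by (auto intro!: A)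
  have "T powr q \<le> N powr (q - 1) * G"
  proof (rule Hoelder_from_Young[OF q _ N])
    show "0 \<le> T" unfolding T_def using g K_nonneg by (intro integral_nonneg_AE AE_I2) auto
    show "0 \<le> G" unfolding G_def using K_nonneg by (intro integral_nonneg_AE AE_I2) auto
    fix l :: real assume l: "0 < l"
    have q': "1 < q'" "1 / q' + 1 / q = 1" using q by (auto simp: q'_def field_simps)
    have young: "g w * K w \<le> l powr q' / q' * (K w * m w powr - (1 / q))
        + l powr (- q) / q * (K w * (m w powr (1 - 1 / q) * g w powr q))" if w: "w \<in> disc" for w
    proof -
      \<comment> \<open>This exponent gives \<open>e * q' = 1 / q\<close> and
        \<open>e * q = 1 - 1 / q\<close>: the weights arising in both Hoelder factors have exponents
        strictly between 0 and 1, the range in which the kernel estimate holds.\<close>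
      define e where "e = (1 - 1 / q) / q"
      define x where "x = l * m w powr - e"
      have x: "x > 0" using l m[OF w] by (simp add: x_def)
      have "x * (g w / x) \<le> x powr q' / q' + (g w / x) powr q / q"
        using x g(2)[OF w] by (intro Youngs_inequality q q') auto
      moreover have "x powr q' = l powr q' * m w powr - (1 / q)"
      proof -
        have "- e * q' = - (1 / q)" using q by (simp add: e_def q'_def field_simps)
        then show ?thesis using l by (simp add: x_def powr_mult powr_powr)
      qed
      moreover have "(g w / x) powr q = l powr (- q) * (m w powr (1 - 1 / q) * g w powr q)"
      proof -
        have "- e * q = - (1 - 1 / q)" using q by (simp add: e_def)
        then have "x powr q = l powr q * m w powr - (1 - 1 / q)"
          using l by (simp only: x_def powr_mult powr_powr)
        then have "x powr q = l powr q / m w powr (1 - 1 / q)"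
          by (simp only: powr_minus divide_inverse)
        moreover have "(g w / x) powr q = g w powr q / x powr q"
          using x g(2)[OF w] by (simp add: powr_divide)
        ultimately show ?thesis
          by (simp add: powr_minus_divide)
      qed
      ultimately have "g w \<le> l powr q' * m w powr - (1 / q) / q' + l powr (- q) * (m w powr (1 - 1 / q) * g w powr q) / q"
        using x by simp
      from mult_right_mono[OF this K_nonneg[of w]] show ?thesis
        by (simp add: algebra_simps)
    qed
    have "T \<le> (LINT w|disc_measure. l powr q' / q' * (K w * m w powr - (1 / q))
        + l powr (- q) / q * (K w * (m w powr (1 - 1 / q) * g w powr q)))"
      unfolding T_def using T_int A_int G_int young by (intro integral_mono) auto
    also have "\<dots> = l powr q' / q' * (LINT w|disc_measure. K w * m w powr - (1 / q)) + l powr (- q) / q * G"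
      unfolding G_def using A_int G_int by simp
    also have "\<dots> \<le> l powr q' / q' * N + l powr (- q) / q * G"
      using A_le q' by (intro add_right_mono mult_left_mono) auto
    finally show "T \<le> l powr (q / (q - 1)) / (q / (q - 1)) * N + l powr (- q) / q * G"
      by (simp add: q'_def)
  qed
  also have "N powr (q - 1) = C powr (q - 1) * m z powr - (1 - 1 / q)"
  proof -
    have "- (1 / q) * (q - 1) = - (1 - 1 / q)" using q by (simp add: field_simps)
    then show ?thesis
      using C by (simp only: N_def powr_mult powr_powr less_imp_le powr_ge_zero)
  qed
  also have "C powr (q - 1) * m z powr - (1 - 1 / q) * G
      = (LINT w|disc_measure. C powr (q - 1) * (m z powr - (1 - 1 / q) * K w * (m w powr (1 - 1 / q) * g w powr q)))"
    unfolding G_def by (simp add: mult.assoc)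
  finally have "ennreal (T powr q) \<le> ennreal (LINT w|disc_measure.
      C powr (q - 1) * (m z powr - (1 - 1 / q) * K w * (m w powr (1 - 1 / q) * g w powr q)))"
    by (rule ennreal_leI)
  also have "\<dots> = (\<integral>\<^sup>+w. ennreal (C powr (q - 1) * (m z powr - (1 - 1 / q) * K w
      * (m w powr (1 - 1 / q) * g w powr q))) \<partial>disc_measure)"
    using G_int K_nonneg by (intro nn_integral_eq_integral[symmetric] AE_I2) (auto simp: mult.assoc)
  finally show ?thesis
    by (simp only: T_def K_def m_def)
qed

text \<open>The second half of Schur's test: the pointwise bound is integrated in \<open>z\<close>,
  the order is exchanged by Tonelli's theorem, and by symmetry of the kernel modulus the same
  estimate applies in \<open>z\<close>, now with exponent \<open>b = 1 - 1 / q\<close>. It produces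
  \<open>m w powr - b\<close>, which cancels the weight \<open>m w powr b\<close>.\<close>

lemma nn_integral_bergman_kernel_finite:
  assumes q: "1 < q" and g: "continuous_on disc g" "\<And>w. w \<in> disc \<Longrightarrow> 0 \<le> g w"
    and g_int: "integrable disc_measure g" and gq_int: "integrable disc_measure (\<lambda>w. g w powr q)"
  shows "(\<integral>\<^sup>+z. ennreal ((LINT w|disc_measure. g w * (1 / norm (1 - z * cnj w) ^ 2)) powr q) \<partial>disc_measure) < \<infinity>"
proof -
  interpret D: finite_measure disc_measure by (rule finite_measure_disc)
  interpret DD: pair_sigma_finite disc_measure disc_measure ..
  define b where "b = 1 - 1 / q"
  have b: "0 < b" "b < 1" using q by (auto simp: b_def)
  define C where "C = pi * (1 / (1 / q) + 1 / (1 - 1 / q))"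
  define C2 where "C2 = pi * (1 / b + 1 / (1 - b))"
  have C2: "C2 \<ge> 0" using b by (auto simp: C2_def intro!: mult_nonneg_nonneg)
  define m where "m = (\<lambda>w::complex. 1 - (norm w)\<^sup>2)"
  have m: "0 < m w" if "w \<in> disc" for w
    using one_minus_norm_square_pos[OF that] by (simp add: m_def)
  define H where "H = (\<lambda>z w. C powr (q - 1) * (m z powr - b * (1 / norm (1 - z * cnj w) ^ 2)
      * (m w powr b * g w powr q)))"
  have gq_cont: "continuous_on disc (\<lambda>w. g w powr q)"
    using g q by (intro continuous_on_powr' continuous_intros) auto
  have meas: "(\<lambda>(z, w). ennreal (H z w)) \<in> borel_measurable (disc_measure \<Otimes>\<^sub>M disc_measure)"
  proof -
    have id: "(\<lambda>w. w) \<in> borel_measurable disc_measure" "cnj \<in> borel_measurable disc_measure"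
      by (intro measurable_disc_continuous continuous_intros)+
    have [measurable]: "fst \<in> borel_measurable (disc_measure \<Otimes>\<^sub>M disc_measure)"
      using measurable_compose[OF measurable_fst id(1)] .
    have [measurable]: "(\<lambda>p. cnj (snd p)) \<in> borel_measurable (disc_measure \<Otimes>\<^sub>M disc_measure)"
      using measurable_compose[OF measurable_snd id(2)] .
    have [measurable]: "(\<lambda>p. m (fst p) powr - b) \<in> borel_measurable (disc_measure \<Otimes>\<^sub>M disc_measure)"
      by (rule measurable_compose[OF measurable_fst])
        (unfold m_def, intro measurable_disc_continuous continuous_on_weight)
    have [measurable]: "(\<lambda>p. m (snd p) powr b * g (snd p) powr q) \<in> borel_measurable (disc_measure \<Otimes>\<^sub>M disc_measure)"
      by (rule measurable_compose[OF measurable_snd])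
        (unfold m_def, intro measurable_disc_continuous continuous_on_mult continuous_on_weight gq_cont)
    show ?thesis
      unfolding H_def case_prod_unfold by measurable
  qed
  have "(\<integral>\<^sup>+z. ennreal ((LINT w|disc_measure. g w * (1 / norm (1 - z * cnj w) ^ 2)) powr q) \<partial>disc_measure)
      \<le> (\<integral>\<^sup>+z. \<integral>\<^sup>+w. ennreal (H z w) \<partial>disc_measure \<partial>disc_measure)"
    unfolding H_def C_def b_def m_def
    by (intro nn_integral_mono bergman_kernel_pointwise q g g_int gq_int) auto
  also have "\<dots> = (\<integral>\<^sup>+w. \<integral>\<^sup>+z. ennreal (H z w) \<partial>disc_measure \<partial>disc_measure)"
    by (rule DD.Fubini'[symmetric, OF meas])
  also have "\<dots> \<le> (\<integral>\<^sup>+w. ennreal (C powr (q - 1) * C2 * g w powr q) \<partial>disc_measure)"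
  proof (rule nn_integral_mono)
    fix w assume "w \<in> space disc_measure"
    then have w: "w \<in> disc" by simp
    define c where "c = C powr (q - 1) * (m w powr b * g w powr q)"
    have c: "c \<ge> 0" by (simp add: c_def)
    have sym: "norm (1 - z * cnj w) = norm (1 - w * cnj z)" for z
      using complex_mod_cnj[of "1 - z * cnj w"] by (simp add: mult.commute)
    have "(\<integral>\<^sup>+z. ennreal (H z w) \<partial>disc_measure)
        = (\<integral>\<^sup>+z. ennreal c * ennreal (1 / (norm (1 - w * cnj z))\<^sup>2 * m z powr - b) \<partial>disc_measure)"
      using c by (simp add: H_def c_def sym ennreal_mult'[symmetric] mult_ac)
    also have "\<dots> = ennreal c * (\<integral>\<^sup>+z. ennreal (1 / (norm (1 - w * cnj z))\<^sup>2 * m z powr - b) \<partial>disc_measure)"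
      unfolding m_def
      by (intro nn_integral_cmult measurable_compose[OF _ measurable_ennreal] measurable_disc_continuous
          continuous_on_mult continuous_on_kernel w continuous_on_weight)
    also have "\<dots> \<le> ennreal c * ennreal (C2 * m w powr - b)"
      unfolding m_def C2_def by (intro mult_left_mono nn_integral_kernel_power2 w b) simp
    also have "\<dots> = ennreal (C powr (q - 1) * C2 * g w powr q * (m w powr b * m w powr - b))"
      using c by (subst ennreal_mult'[symmetric]) (auto simp: c_def mult_ac)
    also have "m w powr b * m w powr - b = 1"
      using m[OF w] by (simp flip: powr_add)
    finally show "(\<integral>\<^sup>+z. ennreal (H z w) \<partial>disc_measure) \<le> ennreal (C powr (q - 1) * C2 * g w powr q)"
      by simp
  qed
  also have "\<dots> = ennreal (LINT w|disc_measure. C powr (q - 1) * C2 * g w powr q)"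
    using gq_int C2 by (intro nn_integral_eq_integral AE_I2) auto
  also have "\<dots> < \<infinity>" by simp
  finally show ?thesis .
qed

section \<open>Estimates with the cubic kernel\<close>

lemma kernel_power_integral:
  assumes z: "z \<in> disc"
  shows "integrable disc_measure (\<lambda>w. 1 / norm (1 - z * cnj w) ^ 3)"
    and "(LINT w|disc_measure. 1 / norm (1 - z * cnj w) ^ 3) \<le> 3 / 2 * pi / (1 - (norm z)\<^sup>2)"
proof -
  have "0 \<le> 3 / 2 * pi / (1 - (norm z)\<^sup>2)"
    using one_minus_norm_square_pos[OF z] by simp
  note A = integral_le_of_nn_integral_le[OF measurable_disc_continuous[OF continuous_on_kernel[OF z]] _
      nn_integral_kernel_power3[OF z] this]
  show "integrable disc_measure (\<lambda>w. 1 / norm (1 - z * cnj w) ^ 3)"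
    and "(LINT w|disc_measure. 1 / norm (1 - z * cnj w) ^ 3) \<le> 3 / 2 * pi / (1 - (norm z)\<^sup>2)"
    by (rule A; simp)+
qed

text \<open>The constant \<open>d\<close> absorbs what stays bounded: the Bloch estimate takes
  \<open>d = 0\<close>, the little Bloch estimate uses it for points far from \<open>z\<close>. The
  factor \<open>pi\<close> is the area of the disc.\<close>

lemma norm_integral_kernel_le:
  fixes f :: "complex \<Rightarrow> complex"
  assumes z: "z \<in> disc" and f: "integrable disc_measure f" and "0 \<le> \<eta>"
    and le: "\<And>w. w \<in> disc \<Longrightarrow> norm (f w) \<le> \<eta> * (1 / norm (1 - z * cnj w) ^ 3) + d"
  shows "norm (LINT w|disc_measure. f w) \<le> \<eta> * (3 / 2 * pi / (1 - (norm z)\<^sup>2)) + d * pi"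
proof -
  have int: "integrable disc_measure (\<lambda>w. \<eta> * (1 / norm (1 - z * cnj w) ^ 3) + d)"
    by (intro Bochner_Integration.integrable_add integrable_mult_right kernel_power_integral z
        integrable_disc_const)
  have "norm (LINT w|disc_measure. f w) \<le> (LINT w|disc_measure. norm (f w))"
    by (rule integral_norm_bound)
  also have "\<dots> \<le> (LINT w|disc_measure. \<eta> * (1 / norm (1 - z * cnj w) ^ 3) + d)"
    using f le by (intro integral_mono int) simp_all
  also have "\<dots> = \<eta> * (LINT w|disc_measure. 1 / norm (1 - z * cnj w) ^ 3) + d * pi"
  proof -
    have "(LINT w|disc_measure. \<eta> * (1 / norm (1 - z * cnj w) ^ 3) + d)
        = (LINT w|disc_measure. \<eta> * (1 / norm (1 - z * cnj w) ^ 3)) + (LINT w|disc_measure. d)"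
      using kernel_power_integral(1)[OF z] integrable_disc_const[of d]
      by (intro Bochner_Integration.integral_add integrable_mult_right)
    then show ?thesis
      by (simp add: measure_disc mult.commute del: times_divide_eq_right)
  qed
  also have "\<dots> \<le> \<eta> * (3 / 2 * pi / (1 - (norm z)\<^sup>2)) + d * pi"
    by (intro add_right_mono mult_left_mono kernel_power_integral z \<open>0 \<le> \<eta>\<close>)
  finally show ?thesis .
qed

text \<open>The difference of the squares is \<open>(1 - |z|^2) * (1 - |w|^2) > 0\<close>;
  equivalently, the pseudohyperbolic distance is below 1. Outside a
  \<open>\<delta>\<close>-neighbourhood of \<open>z\<close> the kernel is therefore bounded by a
  power of \<open>1 / \<delta>\<close>, uniformly in \<open>z\<close>.\<close>

lemma norm_kernel_ge_dist:
  assumes "z \<in> disc" "w \<in> disc"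
  shows "dist w z \<le> norm (1 - z * cnj w)"
proof -
  have "(norm (1 - z * cnj w))\<^sup>2 - (dist w z)\<^sup>2 = (1 - (norm z)\<^sup>2) * (1 - (norm w)\<^sup>2)"
    by (simp add: dist_norm cmod_power2) (simp add: power2_eq_square algebra_simps)
  moreover have "0 < (1 - (norm z)\<^sup>2) * (1 - (norm w)\<^sup>2)"
    using assms by (intro mult_pos_pos one_minus_norm_square_pos)
  ultimately have "(dist w z)\<^sup>2 \<le> (norm (1 - z * cnj w))\<^sup>2"
    by linarith
  then show ?thesis
    by (rule power2_le_imp_le) simp
qed

section \<open>The kernel as a projection, and the three conclusions\<close>

lemma extremal_kernel_representation:
  assumes p: "1 < p" and q: "q = p / (p - 1)" and k: "k \<in> bergman q" and ext: "extremal p k F"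
    and z: "z \<in> disc"
  shows "of_real pi * k z = of_real (Re (kernel_functional k F))
      * (LINT w|disc_measure. powr_gradient p (F w) * (1 / (1 - z * cnj w)\<^sup>2))"
    and "of_real pi * deriv k z / 2 = of_real (Re (kernel_functional k F))
      * (LINT w|disc_measure. powr_gradient p (F w) * (cnj w / (1 - z * cnj w) ^ 3))"
proof -
  have kq: "k holomorphic_on disc" "integrable disc_measure k"
    using k bergman_integrable[of q k] p by (auto simp: bergman_iff q)
  have nz: "1 - cnj z * w \<noteq> 0" if "w \<in> disc" for w
    using one_minus_mult_nonzero[of "cnj z" w] that z by (simp add: disc_def)
  have norm_eq: "norm (1 - cnj z * w) = norm (1 - z * cnj w)" for w
    using complex_mod_cnj[of "1 - z * cnj w"] by simp
  \<comment> \<open>The kernels are antianalytic in \<open>w\<close>, so their conjugates serve as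
    test functions; \<open>|z| < 1\<close> keeps these bounded.\<close>
  define h2 h3 where "h2 = (\<lambda>w. 1 / (1 - cnj z * w)\<^sup>2)" and "h3 = (\<lambda>w. w / (1 - cnj z * w) ^ 3)"
  have hol: "h2 holomorphic_on disc" "h3 holomorphic_on disc"
    unfolding h2_def h3_def using nz by (auto intro!: holomorphic_intros)
  have B2: "norm (h2 w) \<le> 1 / (1 - norm z) ^ 2" if "w \<in> disc" for w
    using norm_inverse_kernel_le[OF z that, of 2] by (simp add: h2_def norm_divide norm_power norm_eq)
  have B3: "norm (h3 w) \<le> 1 / (1 - norm z) ^ 3" if w: "w \<in> disc" for w
  proof -
    have "norm (h3 w) = norm w * (1 / norm (1 - z * cnj w) ^ 3)"
      by (simp add: h3_def norm_divide norm_power norm_eq)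
    also have "\<dots> \<le> 1 * (1 / (1 - norm z) ^ 3)"
      using w norm_inverse_kernel_le[OF z w, of 3] by (intro mult_mono) (auto simp: disc_def)
    finally show ?thesis by simp
  qed
  have cnj_h: "cnj (h2 w) = 1 / (1 - z * cnj w)\<^sup>2" "cnj (h3 w) = cnj w / (1 - z * cnj w) ^ 3" for w
    by (simp_all add: h2_def h3_def)
  show "of_real pi * k z = of_real (Re (kernel_functional k F))
      * (LINT w|disc_measure. powr_gradient p (F w) * (1 / (1 - z * cnj w)\<^sup>2))"
    using extremal_variation[OF p q k ext hol(1) B2] bergman_reproducing[OF kq z]
    unfolding cnj_h by simp
  show "of_real pi * deriv k z / 2 = of_real (Re (kernel_functional k F))
      * (LINT w|disc_measure. powr_gradient p (F w) * (cnj w / (1 - z * cnj w) ^ 3))"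
    using extremal_variation[OF p q k ext hol(2) B3] bergman_reproducing_deriv[OF kq z]
    unfolding cnj_h by simp
qed

text \<open>Taking absolute values inside the projection gives up cancellation, but Schur's test
  bounds the resulting positive operator as well. It is applied to
  \<open>g = M / pi * |F|^(p-1)\<close>, whose \<open>q1\<close>-th power is a multiple of
  \<open>|F|^((p-1) q1)\<close>; integrability of \<open>g\<close> itself comes from
  \<open>F\<close> in \<open>A^p\<close>.\<close>

lemma kernel_in_bergman:
  assumes p: "1 < p" and q: "q = p / (p - 1)" and k: "k \<in> bergman q" and ext: "extremal p k F"
    and q1: "1 < q1" and Fq: "F \<in> bergman ((p - 1) * q1)"
  shows "k \<in> bergman q1"
proof -
  define M where "M = Re (kernel_functional k F)"
  have M: "M \<ge> 0" using extremal_value_nonneg[OF ext] by (simp add: M_def)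
  have F: "F \<in> bergman p" using ext by (simp add: extremal_def)
  have k_hol: "k holomorphic_on disc" using k by (simp add: bergman_iff)
  define g where "g = (\<lambda>w. M / pi * norm (F w) powr (p - 1))"
  have g_cont: "continuous_on disc g"
    unfolding g_def using F p
    by (intro continuous_on_mult continuous_on_const continuous_on_norm_powr)
      (auto simp: bergman_iff intro: holomorphic_on_imp_continuous_on)
  have g_nonneg: "0 \<le> g w" for w using M by (simp add: g_def)
  have g_int: "integrable disc_measure g"
    using integrable_norm[OF powr_gradient_integrable[OF p F]]
    by (simp add: g_def norm_powr_gradient)
  have gq_int: "integrable disc_measure (\<lambda>w. g w powr q1)"
  proof -
    have "g w powr q1 = (M / pi) powr q1 * norm (F w) powr ((p - 1) * q1)" for w
      unfolding g_def using M by (subst powr_mult) (auto simp: powr_powr)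
    then show ?thesis
      using Fq by (simp add: bergman_iff)
  qed
  have le: "norm (k z) \<le> (LINT w|disc_measure. g w * (1 / norm (1 - z * cnj w) ^ 2))" if z: "z \<in> disc" for z
  proof -
    have "pi * norm (k z) = norm (of_real pi * k z)"
      by (simp add: norm_mult)
    also have "\<dots> = M * norm (LINT w|disc_measure. powr_gradient p (F w) * (1 / (1 - z * cnj w)\<^sup>2))"
      unfolding extremal_kernel_representation(1)[OF p q k ext z] using M by (simp add: norm_mult M_def)
    also have "\<dots> \<le> M * (LINT w|disc_measure. norm (powr_gradient p (F w) * (1 / (1 - z * cnj w)\<^sup>2)))"
      using M by (intro mult_left_mono integral_norm_bound)
    also have "\<dots> = pi * (LINT w|disc_measure. M / pi * norm (powr_gradient p (F w) * (1 / (1 - z * cnj w)\<^sup>2)))"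
      by simp
    also have "\<dots> = pi * (LINT w|disc_measure. g w * (1 / norm (1 - z * cnj w) ^ 2))"
      by (simp only: g_def norm_mult norm_powr_gradient norm_divide norm_power norm_one mult.assoc)
    finally show ?thesis by simp
  qed
  have "(\<integral>\<^sup>+z. ennreal (norm (k z) powr q1) \<partial>disc_measure)
      \<le> (\<integral>\<^sup>+z. ennreal ((LINT w|disc_measure. g w * (1 / norm (1 - z * cnj w) ^ 2)) powr q1) \<partial>disc_measure)"
    using le q1 by (intro nn_integral_mono ennreal_leI powr_mono2) auto
  also have "\<dots> < \<infinity>"
    by (rule nn_integral_bergman_kernel_finite[OF q1 g_cont g_nonneg g_int gq_int])
  finally have "integrable disc_measure (\<lambda>z. norm (k z) powr q1)"
    using k_hol q1 by (intro integrableI_nonneg AE_I2 measurable_disc_continuous continuous_on_norm_powr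
        holomorphic_on_imp_continuous_on) auto
  then show ?thesis
    using k_hol by (simp add: bergman_iff)
qed

text \<open>The bounds \<open>|F|^(p-1) \<le> B powr (p - 1)\<close> and \<open>|w| \<le> 1\<close>
  leave only the integral of the cubic kernel. The constant 3 is the 2 of the derivative formula
  times the 3/2 of the kernel estimate.\<close>

lemma kernel_in_bloch:
  assumes p: "1 < p" and q: "q = p / (p - 1)" and k: "k \<in> bergman q" and ext: "extremal p k F"
    and FH: "F \<in> Hinf"
  shows "k \<in> bloch"
proof -
  define M where "M = Re (kernel_functional k F)"
  have M: "M \<ge> 0" using extremal_value_nonneg[OF ext] by (simp add: M_def)
  have F: "F \<in> bergman p" using ext by (simp add: extremal_def)
  obtain B where B: "\<And>w. w \<in> disc \<Longrightarrow> norm (F w) \<le> B"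
    using FH by (auto simp: Hinf_def bounded_iff)
  have "(1 - (norm z)\<^sup>2) * norm (deriv k z) \<le> 3 * M * B powr (p - 1)" if z: "z \<in> disc" for z
  proof -
    have m: "0 < 1 - (norm z)\<^sup>2" by (rule one_minus_norm_square_pos[OF z])
    let ?f = "\<lambda>w. powr_gradient p (F w) * (cnj w / (1 - z * cnj w) ^ 3)"
    have le: "norm (?f w) \<le> B powr (p - 1) * (1 / norm (1 - z * cnj w) ^ 3) + 0" if w: "w \<in> disc" for w
    proof -
      have "norm (?f w) = norm (F w) powr (p - 1) * norm w * (1 / norm (1 - z * cnj w) ^ 3)"
        by (simp add: norm_mult norm_divide norm_power norm_powr_gradient)
      also have "\<dots> \<le> B powr (p - 1) * 1 * (1 / norm (1 - z * cnj w) ^ 3)"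
        using B[OF w] p w by (intro mult_mono powr_mono2) (auto simp: disc_def)
      finally show ?thesis by simp
    qed
    have cont: "continuous_on disc ?f"
      using kernel_nonzero[OF z] F
      by (intro continuous_intros continuous_on_compose2[OF continuous_on_powr_gradient[OF p, of UNIV]])
        (auto simp: bergman_iff intro: holomorphic_on_imp_continuous_on)
    have int: "integrable disc_measure ?f"
    proof (rule integrable_disc_bound[OF cont _ le])
      show "integrable disc_measure (\<lambda>w. B powr (p - 1) * (1 / norm (1 - z * cnj w) ^ 3) + 0)"
        by (intro Bochner_Integration.integrable_add integrable_mult_right kernel_power_integral z
            integrable_disc_const)
    qed
    have "pi * norm (deriv k z) / 2 = norm (of_real pi * deriv k z / 2)"
      by (simp add: norm_mult norm_divide)
    also have "\<dots> = M * norm (LINT w|disc_measure. ?f w)"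
      unfolding extremal_kernel_representation(2)[OF p q k ext z] using M by (simp add: norm_mult M_def)
    also have "\<dots> \<le> M * (B powr (p - 1) * (3 / 2 * pi / (1 - (norm z)\<^sup>2)) + 0 * pi)"
      by (intro mult_left_mono norm_integral_kernel_le z int le M) auto
    also have "\<dots> = pi / 2 * (3 * M * B powr (p - 1) / (1 - (norm z)\<^sup>2))"
      by simp
    finally have "pi / 2 * norm (deriv k z) \<le> pi / 2 * (3 * M * B powr (p - 1) / (1 - (norm z)\<^sup>2))"
      by (simp only: times_divide_eq_left)
    then have "norm (deriv k z) \<le> 3 * M * B powr (p - 1) / (1 - (norm z)\<^sup>2)"
      by (rule mult_left_le_imp_le) simp
    then show ?thesis
      using m by (simp add: pos_le_divide_eq mult.commute)
  qed
  then show ?thesis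
    using k by (auto simp: bloch_def bergman_iff intro!: bdd_aboveI2)
qed

text \<open>The kernel \<open>cnj w / (1 - z cnj w)^3\<close> has mean zero, so the function may be replaced by its
  difference from its value at \<open>z\<close>, which is small near \<open>z\<close>.\<close>

lemma kernel_in_little_bloch:
  assumes p: "1 < p" and q: "q = p / (p - 1)" and k: "k \<in> bergman q" and ext: "extremal p k F"
    and G: "continuous_on (cball 0 1) G" "\<And>z. z \<in> disc \<Longrightarrow> G z = F z"
  shows "k \<in> little_bloch"
proof -
  define M where "M = Re (kernel_functional k F)"
  have M: "M \<ge> 0" using extremal_value_nonneg[OF ext] by (simp add: M_def)
  \<comment> \<open>\<open>G\<close> takes the place of \<open>F\<close> because continuity on the
    compact closed disc is uniform, so that one \<open>\<delta>\<close> serves for all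
    \<open>z\<close>.\<close>
  define J where "J = (\<lambda>w. powr_gradient p (G w))"
  have disc_sub: "disc \<subseteq> cball 0 1" by (auto simp: disc_def)
  have J_cont: "continuous_on (cball 0 1) J"
    unfolding J_def by (intro continuous_on_compose2[OF continuous_on_powr_gradient[OF p, of UNIV] G(1)]) auto
  have J_disc: "continuous_on disc J"
    using J_cont disc_sub by (rule continuous_on_subset)
  obtain B where B: "\<And>w. w \<in> disc \<Longrightarrow> norm (J w) \<le> B" "0 < B"
    using compact_imp_bounded[OF compact_continuous_image[OF J_cont compact_cball]] disc_sub
    by (auto simp: bounded_pos)
  have J_unif: "uniformly_continuous_on (cball 0 1) J"
    using J_cont by (intro compact_uniformly_continuous) auto
  have one: "(\<lambda>_. 1 :: complex) holomorphic_on disc" "integrable disc_measure (\<lambda>_. 1 :: complex)"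
    by (intro holomorphic_intros integrable_disc_const)+
  \<comment> \<open>Near \<open>z\<close> the values of \<open>J\<close> differ by less than
    \<open>\<eta>\<close>; elsewhere the kernel is at most \<open>1 / \<delta> ^ 3\<close> and the
    difference at most \<open>2 * B\<close>. The factor 2 of the derivative formula turns 3/2 into 3
    and \<open>2 * B\<close> into \<open>4 * B\<close>. With \<open>\<eta>\<close> and
    \<open>\<delta>\<close> fixed, the last term tends to 0 at the boundary.\<close>
  have main: "(1 - (norm z)\<^sup>2) * norm (deriv k z) \<le> 3 * M * \<eta> + 4 * M * B / \<delta> ^ 3 * (1 - (norm z)\<^sup>2)"
    if z: "z \<in> disc" and \<eta>: "0 < \<eta>" and \<delta>: "0 < \<delta>"
      and J: "\<And>w. w \<in> disc \<Longrightarrow> dist w z < \<delta> \<Longrightarrow> dist (J w) (J z) < \<eta>" for z \<eta> \<delta>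
  proof -
    have m: "0 < 1 - (norm z)\<^sup>2" by (rule one_minus_norm_square_pos[OF z])
    let ?K = "\<lambda>w. cnj w / (1 - z * cnj w) ^ 3"
    let ?f = "\<lambda>w. (J w - J z) * ?K w"
    have K_cont: "continuous_on disc ?K"
      using kernel_nonzero[OF z] by (intro continuous_intros) auto
    have K_norm: "norm (?K w) \<le> 1 / norm (1 - z * cnj w) ^ 3" if "w \<in> disc" for w
      using that by (simp add: norm_divide norm_power disc_def divide_right_mono)
    have K_int: "integrable disc_measure ?K"
      using integrable_disc_bound[OF K_cont kernel_power_integral(1)[OF z] K_norm] .
    have JK_int: "integrable disc_measure (\<lambda>w. J w * ?K w)"
    proof (rule integrable_disc_bound)
      show "continuous_on disc (\<lambda>w. J w * ?K w)" by (intro continuous_on_mult J_disc K_cont)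
      show "integrable disc_measure (\<lambda>w. B * (1 / norm (1 - z * cnj w) ^ 3))"
        by (intro integrable_mult_right kernel_power_integral z)
      show "norm (J w * ?K w) \<le> B * (1 / norm (1 - z * cnj w) ^ 3)" if "w \<in> disc" for w
        unfolding norm_mult using B K_norm[OF that] that by (intro mult_mono) auto
    qed
    \<comment> \<open>This is the derivative formula for the constant function 1.\<close>
    have "(LINT w|disc_measure. ?K w) = 0"
      using bergman_reproducing_deriv[OF one z] by simp
    then have f_eq: "(LINT w|disc_measure. ?f w) = (LINT w|disc_measure. J w * ?K w)"
      unfolding left_diff_distrib using JK_int K_int by (subst Bochner_Integration.integral_diff) (auto simp del: times_divide_eq_right)
    have f_int: "integrable disc_measure ?f"
      unfolding left_diff_distrib using JK_int K_int by (intro Bochner_Integration.integrable_diff integrable_mult_right)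
    have le: "norm (?f w) \<le> \<eta> * (1 / norm (1 - z * cnj w) ^ 3) + 2 * B / \<delta> ^ 3" if w: "w \<in> disc" for w
    proof (cases "dist w z < \<delta>")
      case True
      have "norm (?f w) \<le> \<eta> * (1 / norm (1 - z * cnj w) ^ 3)"
        unfolding norm_mult using J[OF w True] K_norm[OF w] \<eta>
        by (intro mult_mono) (auto simp: dist_norm)
      then show ?thesis using B \<delta> by (simp add: add_increasing2)
    next
      case False
      then have "\<delta> \<le> norm (1 - z * cnj w)"
        using norm_kernel_ge_dist[OF z w] by simp
      then have "1 / norm (1 - z * cnj w) ^ 3 \<le> 1 / \<delta> ^ 3"
        using \<delta> by (intro divide_left_mono power_mono mult_pos_pos zero_less_power) auto
      moreover have "norm (J w - J z) \<le> B + B"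
        using norm_triangle_ineq4[of "J w" "J z"] B(1)[OF w] B(1)[OF z] by simp
      ultimately have "norm (?f w) \<le> (B + B) * (1 / \<delta> ^ 3)"
        unfolding norm_mult using K_norm[OF w] B by (intro mult_mono) auto
      then show ?thesis using \<eta> by (simp add: add_increasing)
    qed
    have JF: "(LINT w|disc_measure. J w * ?K w) = (LINT w|disc_measure. powr_gradient p (F w) * ?K w)"
      using G(2) by (intro Bochner_Integration.integral_cong) (auto simp: J_def)
    have "pi * norm (deriv k z) / 2 = norm (of_real pi * deriv k z / 2)"
      by (simp add: norm_mult norm_divide)
    also have "\<dots> = M * norm (LINT w|disc_measure. ?f w)"
      unfolding extremal_kernel_representation(2)[OF p q k ext z] f_eq JF using M by (simp add: norm_mult M_def)
    also have "\<dots> \<le> M * (\<eta> * (3 / 2 * pi / (1 - (norm z)\<^sup>2)) + 2 * B / \<delta> ^ 3 * pi)"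
      using \<eta> by (intro mult_left_mono norm_integral_kernel_le z f_int le M) auto
    also have "\<dots> = pi / 2 * (3 * M * \<eta> / (1 - (norm z)\<^sup>2) + 4 * M * B / \<delta> ^ 3)"
      using m \<delta> by (simp add: field_simps)
    finally have "norm (deriv k z) \<le> 3 * M * \<eta> / (1 - (norm z)\<^sup>2) + 4 * M * B / \<delta> ^ 3"
      by simp
    from mult_left_mono[OF this less_imp_le[OF m]] show ?thesis
      using m by (simp add: distrib_left mult.commute)
  qed
  show ?thesis
    unfolding little_bloch_def
  proof (intro CollectI conjI allI impI)
    show "k holomorphic_on disc" using k by (simp add: bergman_iff)
    fix e :: real assume e: "0 < e"
    \<comment> \<open>The denominator makes \<open>3 * M * \<eta>\<close> strictly less than
      \<open>e / 2\<close>, one half of the allowance.\<close>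
    define \<eta> where "\<eta> = e / (6 * M + 1)"
    have \<eta>: "\<eta> > 0" "3 * M * \<eta> < e / 2"
      using e M by (auto simp: \<eta>_def field_simps add_pos_nonneg)
    obtain \<delta> where \<delta>: "\<delta> > 0"
      "\<And>w z. w \<in> cball 0 1 \<Longrightarrow> z \<in> cball 0 1 \<Longrightarrow> dist w z < \<delta> \<Longrightarrow> dist (J w) (J z) < \<eta>"
      using J_unif \<eta>(1) unfolding uniformly_continuous_on_def by (metis dist_commute)
    define D where "D = 4 * M * B / \<delta> ^ 3"
    have D: "D \<ge> 0" using M B \<delta> by (simp add: D_def)
    \<comment> \<open>For \<open>norm z > 1 - \<tau>\<close> one has
      \<open>1 - |z|^2 \<le> 2 * \<tau>\<close>, and the denominator is chosen to make
      \<open>D * (2 * \<tau>) < e / 2\<close>, the other half.\<close>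
    define \<tau> where "\<tau> = e / (4 * D + 4)"
    have \<tau>: "\<tau> > 0" "D * (2 * \<tau>) < e / 2"
      using e D by (auto simp: \<tau>_def field_simps add_nonneg_pos)
    show "\<exists>r<1. \<forall>z\<in>disc. r < norm z \<longrightarrow> (1 - (norm z)\<^sup>2) * norm (deriv k z) < e"
    proof (intro exI[of _ "1 - \<tau>"] conjI ballI impI)
      show "1 - \<tau> < 1" using \<tau> by simp
      fix z assume z: "z \<in> disc" and r: "1 - \<tau> < norm z"
      have "1 - (norm z)\<^sup>2 = (1 - norm z) * (1 + norm z)"
        by (simp add: power2_eq_square algebra_simps)
      also have "\<dots> \<le> \<tau> * 2"
        using z r by (intro mult_mono) (auto simp: disc_def)
      finally have "D * (1 - (norm z)\<^sup>2) \<le> D * (2 * \<tau>)"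
        using D by (intro mult_left_mono) auto
      moreover have "(1 - (norm z)\<^sup>2) * norm (deriv k z) \<le> 3 * M * \<eta> + D * (1 - (norm z)\<^sup>2)"
        unfolding D_def
        by (rule main[OF z \<eta>(1) \<delta>(1)], rule \<delta>(2)) (use z disc_sub in auto)
      ultimately show "(1 - (norm z)\<^sup>2) * norm (deriv k z) < e"
        using \<eta> \<tau> by linarith
    qed
  qed
qed

theorem theorem5p1:
  fixes p q :: real and k F :: "complex \<Rightarrow> complex"
  assumes "1 < p" and "q = p / (p - 1)"
    and "k \<in> bergman q" and "\<exists>z\<in>disc. k z \<noteq> 0"
    and "extremal p k F"
  shows "(\<forall>q1::real. 1 < q1 \<longrightarrow> F \<in> bergman ((p - 1) * q1) \<longrightarrow> k \<in> bergman q1)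
       \<and> (F \<in> Hinf \<longrightarrow> k \<in> bloch)
       \<and> ((\<exists>G. continuous_on (cball 0 1) G \<and> (\<forall>z\<in>disc. G z = F z)) \<longrightarrow> k \<in> little_bloch)"
proof (intro conjI allI impI)
  show "k \<in> bergman q1" if "1 < q1" "F \<in> bergman ((p - 1) * q1)" for q1
    using kernel_in_bergman[OF assms(1-3,5) that] .
  show "k \<in> bloch" if "F \<in> Hinf"
    using kernel_in_bloch[OF assms(1-3,5) that] .
  show "k \<in> little_bloch" if "\<exists>G. continuous_on (cball 0 1) G \<and> (\<forall>z\<in>disc. G z = F z)"
    using that kernel_in_little_bloch[OF assms(1-3,5)] by auto
qed

end
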